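(* Let $F=(F_n)_{n\in\mathbb Z}$ be a finitely supported sequence of complex numbers with $|F_n|<1$ for all $n$, put $A_n=(1-|F_n|^2)^{-1/2}$ and $B_n=A_nF_n$, and let $a(t)$ be the $(1,1)$ entry of the ordered product $$\begin{pmatrix}a(t)&b(t)\\\overline{b(t)}&\overline{a(t)}\end{pmatrix}=\prod^{\longrightarrow}_{n\in\operatorname{supp}F}\begin{pmatrix}A_n&B_n e^{2\pi i n t}\\\overline{B_n}e^{-2\pi i n t}&A_n\end{pmatrix},\qquad t\in\mathbb T .$$ Then for all $1\le p\le 2$, $$\big\|(\log|a|^2)^{1/2}\big\|_{L^{p'}(\mathbb T)}\le\big\|(\log A_n^2)^{1/2}\big\|_{\ell^p(\mathbb Z)} .$$ If $F$ has a single nonzero coefficient, equality holds for every $1\le p\le2$. For an arbitrary finitely supported $F$ (with $|F_n|<1$), equality holds at $p=2$.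
   Context: $\mathbb T=\mathbb R/\mathbb Z$ with Lebesgue measure of total mass $1$. $p'=p/(p-1)$ is the conjugate exponent, with $1'=\infty$. The product is taken over the finite set $\operatorname{supp}F=\{n:F_n\neq0\}$, multiplied from left to right as $n$ increases (the empty product is the identity). Each factor lies in $\mathrm{SU}(1,1)$, so $|a(t)|^2-|b(t)|^2=1$ and hence $\log|a(t)|^2\ge0$. The right-hand norm is the $\ell^p$ norm over $n\in\mathbb Z$ of the sequence $n\mapsto(\log A_n^2)^{1/2}=(-\log(1-|F_n|^2))^{1/2}$. *)

theory Defs
  imports "HOL-Analysis.Analysis" "HOL-Probability.Essential_Supremum"
begin

text \<open>
  The circle \<open>\<real>/\<int>\<close> is represented by its fundamental domain \<open>[0,1)\<close>; functions on the circle
  are 1-periodic functions on the reals.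
\<close>

definition circle_measure :: "real measure" where
  "circle_measure = lebesgue_on {0..<1}"

text \<open>
  The \<open>L\<^sup>q\<close> norm for \<open>0 < q \<le> \<infinity>\<close>, with values in \<open>[0,\<infinity>]\<close>. Over the counting measure it is the
  \<open>\<ell>\<^sup>q\<close> norm. The inner case distinction extends the power \<open>I \<mapsto> I\<^bsup>1/q\<^esup>\<close> from the
  nonnegative reals to \<open>I = \<infinity>\<close>.
\<close>

definition Lp_norm :: "'a measure \<Rightarrow> ennreal \<Rightarrow> ('a \<Rightarrow> real) \<Rightarrow> ennreal" where
  "Lp_norm M q f =
    (if q = \<infinity> then esssup M (\<lambda>x. ennreal \<bar>f x\<bar>)
     else let I = \<integral>\<^sup>+ x. ennreal (\<bar>f x\<bar> powr enn2real q) \<partial>M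
          in if I = \<infinity> then \<infinity> else ennreal (enn2real I powr (1 / enn2real q)))"

definition conj_exponent :: "real \<Rightarrow> ennreal" where
  "conj_exponent p = (if p = 1 then \<infinity> else ennreal (p / (p - 1)))"

definition nlft_A :: "(int \<Rightarrow> complex) \<Rightarrow> int \<Rightarrow> real" where
  "nlft_A F n = (1 - (cmod (F n))\<^sup>2) powr (- 1 / 2)"

definition nlft_B :: "(int \<Rightarrow> complex) \<Rightarrow> int \<Rightarrow> complex" where
  "nlft_B F n = of_real (nlft_A F n) * F n"

definition nlft_factor :: "(int \<Rightarrow> complex) \<Rightarrow> real \<Rightarrow> int \<Rightarrow> complex ^ 2 ^ 2" where
  "nlft_factor F t n = vector
     [vector [of_real (nlft_A F n), nlft_B F n * exp (2 * of_real pi * \<i> * of_int n * of_real t)],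
      vector [cnj (nlft_B F n) * exp (- 2 * of_real pi * \<i> * of_int n * of_real t), of_real (nlft_A F n)]]"

definition nlft_matrix :: "(int \<Rightarrow> complex) \<Rightarrow> real \<Rightarrow> complex ^ 2 ^ 2" where
  "nlft_matrix F t =
     foldr (\<lambda>n P. nlft_factor F t n ** P) (sorted_list_of_set {n. F n \<noteq> 0}) (mat 1)"

definition nlft_a :: "(int \<Rightarrow> complex) \<Rightarrow> real \<Rightarrow> complex" where
  "nlft_a F t = nlft_matrix F t $ 1 $ 1"

definition nlft_b :: "(int \<Rightarrow> complex) \<Rightarrow> real \<Rightarrow> complex" where
  "nlft_b F t = nlft_matrix F t $ 1 $ 2"

lemma nlft_factor_entries:
  "nlft_factor F t n $ 1 $ 1 = of_real (nlft_A F n)"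
  "nlft_factor F t n $ 1 $ 2 = nlft_B F n * exp (2 * of_real pi * \<i> * of_int n * of_real t)"
  "nlft_factor F t n $ 2 $ 1 = cnj (nlft_B F n * exp (2 * of_real pi * \<i> * of_int n * of_real t))"
  "nlft_factor F t n $ 2 $ 2 = of_real (nlft_A F n)"
  by (simp_all add: nlft_factor_def exp_cnj)

lemma nlft_matrix_form:
  "nlft_matrix F t = vector [vector [nlft_a F t, nlft_b F t],
                             vector [cnj (nlft_b F t), cnj (nlft_a F t)]]"
proof -
  define P where "P = (\<lambda>xs. foldr (\<lambda>n P. nlft_factor F t n ** P) xs (mat 1 :: complex^2^2))"
  have "P xs $ 2 $ 1 = cnj (P xs $ 1 $ 2) \<and> P xs $ 2 $ 2 = cnj (P xs $ 1 $ 1)" for xs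
  proof (induction xs)
    case Nil
    show ?case by (simp add: P_def mat_def)
  next
    case (Cons n xs)
    have "P (n # xs) = nlft_factor F t n ** P xs" by (simp add: P_def)
    then show ?case using Cons.IH
      by (simp add: matrix_matrix_mult_def sum_2 nlft_factor_entries)
  qed
  then show ?thesis
    by (simp add: vec_eq_iff forall_2 nlft_a_def nlft_b_def nlft_matrix_def P_def)
qed

lemma nlft_det:
  assumes "\<And>n. cmod (F n) < 1"
  shows "(cmod (nlft_a F t))\<^sup>2 - (cmod (nlft_b F t))\<^sup>2 = 1"
proof -
  have factor: "det (nlft_factor F t n) = 1" for n
  proof -
    have pos: "0 < 1 - (cmod (F n))\<^sup>2"
      using assms[of n] by (simp add: power_less_one_iff abs_square_less_1)
    have "(nlft_A F n)\<^sup>2 = (1 - (cmod (F n))\<^sup>2) powr (- 1)"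
      unfolding nlft_A_def power2_eq_square powr_add[symmetric] by simp
    then have A2: "(nlft_A F n)\<^sup>2 * (1 - (cmod (F n))\<^sup>2) = 1"
      using pos by (simp add: powr_minus)
    have "(cmod (exp (2 * of_real pi * \<i> * of_int n * of_real t)))\<^sup>2 = 1" by simp
    then have "det (nlft_factor F t n)
        = of_real ((nlft_A F n)\<^sup>2 * (1 - (cmod (F n))\<^sup>2))"
      unfolding det_2 nlft_factor_entries complex_norm_square[symmetric] nlft_B_def
      by (simp add: norm_mult power_mult_distrib algebra_simps power2_eq_square
            complex_norm_square[symmetric] flip: of_real_mult)
    then show ?thesis using A2 by simp
  qed
  have "det (foldr (\<lambda>n P. nlft_factor F t n ** P) xs (mat 1)) = 1" for xs
    by (induction xs) (simp_all add: det_mul factor)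
  then have "det (nlft_matrix F t) = 1" by (simp add: nlft_matrix_def)
  then have "complex_of_real ((cmod (nlft_a F t))\<^sup>2 - (cmod (nlft_b F t))\<^sup>2) = of_real 1"
    by (subst (asm) nlft_matrix_form) (simp add: det_2 flip: complex_norm_square)
  then show ?thesis by (simp only: of_real_eq_iff)
qed

end

theory Submission
  imports Defs "HOL-Complex_Analysis.Conformal_Mappings"
begin

text \<open>
  The nonlinear inequality is the linear interpolation theorem of Riesz and
  Thorin, read in the right Hilbert space. Each matrix of the product acts on the unit disc by a
  Moebius transformation. Applying the partial products to the origin gives, for every \<open>t\<close>, a
  polygonal path \<open>0 = w\<^sub>0, w\<^sub>1, \<dots>, w\<^sub>N\<close> in the disc. Embed the disc into \<open>\<ell>\<^sup>2\<close> by
  \<open>\<Psi>(w) = (w\<^sup>k / \<surd>k)\<^sub>k\<close>, with \<open>k \<ge> 1\<close>. The power series of the logarithm gives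
  \<open>|\<Psi>(w) - \<Psi>(z)|\<^sup>2 = 2 log |1 - w cnj z| - log (1 - |w|\<^sup>2) - log (1 - |z|\<^sup>2)\<close>,
  and the right-hand side is invariant under Moebius transformations of the disc. By this invariance
  the squared distance between \<open>\<Psi>(w\<^sub>i)\<close> and \<open>\<Psi>(w\<^sub>j)\<close> is \<open>log |a|\<^sup>2\<close> for the product of the factors
  \<open>i + 1, \<dots>, j\<close> alone (\<open>disc_sqdist_orbit\<close>). So the increments
  \<open>\<Delta>\<^sub>j = \<Psi>(w\<^sub>j) - \<Psi>(w\<^sub>j\<^sub>-\<^sub>1)\<close> have constant length, \<open>|\<Delta>\<^sub>j|\<^sup>2 = log A\<^sub>j\<^sup>2\<close>, and their sum \<open>\<Psi>(w\<^sub>N)\<close> satisfies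
  \<open>|\<Sigma> \<Delta>\<^sub>j|\<^sup>2 = log |a|\<^sup>2\<close>.

  The increments are moreover orthogonal on average over \<open>t\<close>. Indeed, \<open>log |a|\<^sup>2\<close> of any such
  product has mean \<open>\<Sigma> log A\<^sub>n\<^sup>2\<close>, because \<open>a\<close> is the conjugate of the boundary values of a
  holomorphic function without zeros in the disc (\<open>has_integral_ln_partial_a\<close>). The mean squared
  distance along the path is therefore additive, and polarization makes the mixed inner products
  vanish in the mean (\<open>disc_inner_orthogonal\<close>). Here \<open>\<ell>\<^sup>2\<close> is regarded as a real Hilbert space: the
  inner products are the real parts of the complex ones.

  Hence the linear operator \<open>c \<mapsto> \<Sigma> c\<^sub>j \<Delta>\<^sub>j / |\<Delta>\<^sub>j|\<close> is a contraction from \<open>\<ell>\<^sup>1\<close> to \<open>L\<^sup>\<infinity>\<close>, since it sums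
  unit vectors, and from \<open>\<ell>\<^sup>2\<close> to \<open>L\<^sup>2\<close>, since these are orthonormal in the mean. Interpolation makes
  it a contraction from \<open>\<ell>\<^sup>p\<close> to \<open>L\<^sup>p\<^sup>'\<close> (\<open>gram_hausdorff_young\<close>), and the choice \<open>c\<^sub>j = |\<Delta>\<^sub>j|\<close> is the
  claim. At \<open>p = 2\<close> the mean value of \<open>log |a|\<^sup>2\<close> gives equality at once, and for a single factor both
  sides are norms of the same constant.

  Only inner products of the vectors \<open>\<Delta>\<^sub>j\<close> enter the argument. The formal proof thus works with the
  Gram matrices of these vectors and does not construct \<open>\<ell>\<^sup>2\<close>.
\<close>

section \<open>Two tools from complex analysis\<close>

lemma circle_mean_value:
  assumes cont: "continuous_on (cball 0 1) f" and hol: "f holomorphic_on ball 0 1"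
  shows "((\<lambda>t. f (exp (2 * of_real pi * \<i> * of_real t))) has_integral f 0) {0..1}"
proof -
  have "((\<lambda>z. f z / (z - 0)) has_contour_integral (2 * of_real pi * \<i> * f 0)) (circlepath 0 1)"
    by (rule Cauchy_integral_circlepath[OF cont hol]) simp
  then have "((\<lambda>t. f (circlepath 0 1 t) / circlepath 0 1 t
      * vector_derivative (circlepath 0 1) (at t)) has_integral 2 * of_real pi * \<i> * f 0) {0..1}"
    by (simp add: has_contour_integral)
  then have "((\<lambda>t. 1 / (2 * of_real pi * \<i>) * (f (circlepath 0 1 t) / circlepath 0 1 t
      * vector_derivative (circlepath 0 1) (at t))) has_integral
      1 / (2 * of_real pi * \<i>) * (2 * of_real pi * \<i> * f 0)) {0..1}"
    by (rule has_integral_mult_right)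
  moreover have "1 / (2 * of_real pi * \<i>) * (f (circlepath 0 1 t) / circlepath 0 1 t
      * vector_derivative (circlepath 0 1) (at t)) = f (exp (2 * of_real pi * \<i> * of_real t))" for t
    by (subst vector_derivative_circlepath) (simp add: circlepath)
  ultimately show ?thesis by simp
qed

text \<open>
  Hadamard's theorem, normalized to the bound \<open>1\<close>. The strip is unbounded, so the maximum principle
  is applied to \<open>f(z) exp (\<delta>(z\<^sup>2 - 1))\<close>: the factor is at most \<open>1\<close> on the strip and decays as
  \<open>|Im z|\<close> grows, which reduces the problem to a rectangle. Then \<open>\<delta>\<close> tends to \<open>0\<close>.
\<close>

lemma three_lines:
  fixes f :: "complex \<Rightarrow> complex"
  assumes hol: "f holomorphic_on UNIV"
    and bound: "\<And>z. 0 \<le> Re z \<Longrightarrow> Re z \<le> 1 \<Longrightarrow> cmod (f z) \<le> B"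
    and left: "\<And>z. Re z = 0 \<Longrightarrow> cmod (f z) \<le> 1"
    and right: "\<And>z. Re z = 1 \<Longrightarrow> cmod (f z) \<le> 1"
    and w: "0 \<le> Re w" "Re w \<le> 1"
  shows "cmod (f w) \<le> 1"
proof -
  have damped: "cmod (f w) * exp (\<delta> * ((Re w)\<^sup>2 - (Im w)\<^sup>2 - 1)) \<le> 1" if \<delta>: "\<delta> > 0" for \<delta>
  proof -
    define g where "g z = f z * exp (of_real \<delta> * (z\<^sup>2 - 1))" for z
    have cmod_g: "cmod (g z) = cmod (f z) * exp (\<delta> * ((Re z)\<^sup>2 - (Im z)\<^sup>2 - 1))" for z
      by (simp add: g_def norm_mult Re_power2)
    \<comment> \<open>Tall enough that the damping beats \<open>B\<close> on the horizontal edges, as \<open>B \<le> \<delta> R \<le> \<delta> R\<^sup>2 \<le> exp (\<delta> R\<^sup>2)\<close>.\<close>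
    define R where "R = max (max 1 \<bar>Im w\<bar>) (B / \<delta>)"
    have R: "R \<ge> 1" "\<bar>Im w\<bar> \<le> R" "B / \<delta> \<le> R" by (auto simp: R_def)
    have "R \<le> R\<^sup>2" using R(1) by (simp add: power2_eq_square)
    then have "B \<le> \<delta> * R\<^sup>2" using R(3) \<delta> by (simp add: pos_divide_le_eq mult.commute[of _ \<delta>])
      (meson mult_left_mono less_imp_le order_trans)
    then have B: "B \<le> exp (\<delta> * R\<^sup>2)" using exp_ge_add_one_self[of "\<delta> * R\<^sup>2"] by linarith
    let ?S = "cbox (Complex 0 (- R)) (Complex 1 R)"
    have "cmod (g w) \<le> 1"
    proof (rule maximum_modulus_frontier[where f = g and S = ?S])
      have "g holomorphic_on UNIV" unfolding g_def by (intro holomorphic_intros hol)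
      then show "g holomorphic_on interior ?S" "continuous_on (closure ?S) g"
        using holomorphic_on_imp_continuous_on holomorphic_on_subset by blast+
      show "bounded ?S" by simp
      show "w \<in> ?S" using w R by (auto simp: in_cbox_complex_iff)
      fix z assume "z \<in> frontier ?S"
      then have "z \<in> ?S" "z \<notin> box (Complex 0 (- R)) (Complex 1 R)" by (auto simp: frontier_cbox)
      then have z: "0 \<le> Re z" "Re z \<le> 1"
        and cases: "Re z = 0 \<or> Re z = 1 \<or> \<bar>Im z\<bar> = R"
        by (auto simp: in_cbox_complex_iff in_box_complex_iff)
      have x2: "(Re z)\<^sup>2 \<le> 1" using z by (simp add: power_le_one)
      have "(Re z)\<^sup>2 - (Im z)\<^sup>2 - 1 \<le> 0" using x2 zero_le_power2[of "Im z"] by linarith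
      then have e: "exp (\<delta> * ((Re z)\<^sup>2 - (Im z)\<^sup>2 - 1)) \<le> 1"
        using \<delta> by (simp add: mult_nonneg_nonpos)
      show "cmod (g z) \<le> 1"
      proof (cases "\<bar>Im z\<bar> = R")
        case True
        then have I: "(Im z)\<^sup>2 = R\<^sup>2" by (metis power2_abs)
        have "cmod (f z) \<le> exp (\<delta> * R\<^sup>2)" using bound[OF z] B by linarith
        moreover have "exp (\<delta> * ((Re z)\<^sup>2 - (Im z)\<^sup>2 - 1)) \<le> exp (- (\<delta> * R\<^sup>2))"
          using x2 \<delta> by (simp add: I algebra_simps)
        ultimately have "cmod (g z) \<le> exp (\<delta> * R\<^sup>2) * exp (- (\<delta> * R\<^sup>2))"
          unfolding cmod_g by (intro mult_mono) auto
        then show ?thesis by (simp flip: exp_add)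
      next
        case False
        then have "cmod (f z) \<le> 1" using cases left right by blast
        then show ?thesis unfolding cmod_g using e by (simp add: mult_le_one)
      qed
    qed
    then show ?thesis by (simp add: cmod_g)
  qed
  have "((\<lambda>\<delta>. cmod (f w) * exp (\<delta> * ((Re w)\<^sup>2 - (Im w)\<^sup>2 - 1))) \<longlongrightarrow>
      cmod (f w) * exp (0 * ((Re w)\<^sup>2 - (Im w)\<^sup>2 - 1))) (at_right 0)"
    by (intro tendsto_intros)
  moreover have "\<forall>\<^sub>F \<delta> in at_right 0. cmod (f w) * exp (\<delta> * ((Re w)\<^sup>2 - (Im w)\<^sup>2 - 1)) \<le> 1"
    using damped by (simp add: eventually_at_filter)
  ultimately have "cmod (f w) * exp (0 * ((Re w)\<^sup>2 - (Im w)\<^sup>2 - 1)) \<le> 1"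
    by (rule tendsto_upperbound) simp
  then show ?thesis by simp
qed

section \<open>Interpolation for vectors that are orthogonal in the mean\<close>

lemma cauchy_schwarz_psd_form:
  fixes G :: "'j \<Rightarrow> 'j \<Rightarrow> real"
  assumes sym: "\<And>i j. i \<in> J \<Longrightarrow> j \<in> J \<Longrightarrow> G i j = G j i"
    and psd: "\<And>x. 0 \<le> (\<Sum>i\<in>J. \<Sum>j\<in>J. x i * x j * G i j)"
  shows "(\<Sum>i\<in>J. \<Sum>j\<in>J. x i * y j * G i j)\<^sup>2
    \<le> (\<Sum>i\<in>J. \<Sum>j\<in>J. x i * x j * G i j) * (\<Sum>i\<in>J. \<Sum>j\<in>J. y i * y j * G i j)"
proof -
  define b where "b x y = (\<Sum>i\<in>J. \<Sum>j\<in>J. x i * y j * G i j)" for x y :: "'j \<Rightarrow> real"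
  have b_sym: "b x y = b y x" for x y
    unfolding b_def by (subst sum.swap) (auto intro!: sum.cong simp: sym)
  have expand: "b (\<lambda>i. s * x i + t * y i) (\<lambda>i. s * x i + t * y i)
      = s\<^sup>2 * b x x + 2 * s * t * b x y + t\<^sup>2 * b y y" for s t
  proof -
    have "b (\<lambda>i. s * x i + t * y i) (\<lambda>i. s * x i + t * y i)
        = s\<^sup>2 * b x x + s * t * b x y + s * t * b y x + t\<^sup>2 * b y y"
      unfolding b_def by (simp add: algebra_simps sum.distrib sum_distrib_left power2_eq_square)
    then show ?thesis using b_sym[of x y] by simp
  qed
  have nonneg: "0 \<le> b z z" for z using psd[of z] by (simp add: b_def)
  have quad: "0 \<le> s\<^sup>2 * b x x + 2 * s * t * b x y + t\<^sup>2 * b y y" for s t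
    using nonneg[of "\<lambda>i. s * x i + t * y i"] unfolding expand .
  have "(b x y)\<^sup>2 \<le> b x x * b y y"
  proof (cases "b x x = 0")
    case True
    have "b x y = 0"
    proof (rule ccontr)
      assume "b x y \<noteq> 0"
      \<comment> \<open>The form vanishes at \<open>x\<close>; at this point of the plane of \<open>x\<close> and \<open>y\<close> it would equal \<open>-1\<close>.\<close>
      then show False
        using quad[of "- (b y y + 1) / (2 * b x y)" 1] True by (simp add: field_simps)
    qed
    then show ?thesis using True by simp
  next
    case False
    then have pos: "b x x > 0" using nonneg[of x] by simp
    have "0 \<le> b x x * (b x x * b y y - (b x y)\<^sup>2)"
      using quad[of "- b x y" "b x x"] by (simp add: algebra_simps power2_eq_square)
    then show ?thesis using pos by (simp add: zero_le_mult_iff)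
  qed
  then show ?thesis by (simp add: b_def)
qed

text \<open>
  \<open>G i j t\<close> stands for the inner product of two vectors \<open>\<Delta>\<^sub>i(t)\<close> and \<open>\<Delta>\<^sub>j(t)\<close> of a real Hilbert space.
  The lengths \<open>|\<Delta>\<^sub>j(t)| = y\<^sub>j\<close> do not depend on \<open>t\<close>, and distinct vectors are orthogonal after
  integration over \<open>t\<close>. The function \<open>norm_sum_sq\<close> below is then \<open>|\<Sigma> \<Delta>\<^sub>j|\<^sup>2\<close>.
\<close>

locale gram_family =
  fixes J :: "'j set" and y :: "'j \<Rightarrow> real" and G :: "'j \<Rightarrow> 'j \<Rightarrow> real \<Rightarrow> real"
  assumes J: "finite J"
    and y_pos: "\<And>j. j \<in> J \<Longrightarrow> 0 < y j"
    and cont: "\<And>i j. i \<in> J \<Longrightarrow> j \<in> J \<Longrightarrow> continuous_on {0..1} (G i j)"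
    and sym: "\<And>i j t. i \<in> J \<Longrightarrow> j \<in> J \<Longrightarrow> t \<in> {0..1} \<Longrightarrow> G i j t = G j i t"
    and psd: "\<And>x t. t \<in> {0..1} \<Longrightarrow> 0 \<le> (\<Sum>i\<in>J. \<Sum>j\<in>J. x i * x j * G i j t)"
    and diag: "\<And>j t. j \<in> J \<Longrightarrow> t \<in> {0..1} \<Longrightarrow> G j j t = (y j)\<^sup>2"
    and orth: "\<And>i j. i \<in> J \<Longrightarrow> j \<in> J \<Longrightarrow> i \<noteq> j \<Longrightarrow> (G i j has_integral 0) {0..1}"
begin

definition norm_sum_sq :: "real \<Rightarrow> real" where
  "norm_sum_sq t = (\<Sum>i\<in>J. \<Sum>j\<in>J. G i j t)"

lemma norm_sum_sq_nonneg: "t \<in> {0..1} \<Longrightarrow> 0 \<le> norm_sum_sq t"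
  using psd[of t "\<lambda>_. 1"] by (simp add: norm_sum_sq_def)

lemma continuous_on_norm_sum_sq: "continuous_on {0..1} norm_sum_sq"
  unfolding norm_sum_sq_def by (intro continuous_on_sum cont)

text \<open>The triangle inequality for \<open>\<Sigma> \<Delta>\<^sub>j\<close>, which is the endpoint \<open>p = 1\<close>.\<close>

lemma sqrt_norm_sum_sq_le_sum:
  assumes t: "t \<in> {0..1}"
  shows "sqrt (norm_sum_sq t) \<le> (\<Sum>j\<in>J. y j)"
proof -
  have "G i j t \<le> y i * y j" if ij: "i \<in> J" "j \<in> J" for i j
  proof -
    let ?d = "\<lambda>k l. if l = k then 1 else 0 :: real"
    have "(\<Sum>a\<in>J. \<Sum>b\<in>J. ?d k a * ?d l b * G a b t) = G k l t" if "k \<in> J" "l \<in> J" for k l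
      using J that by (simp add: if_distrib[of "\<lambda>a. a * _"] if_distrib[of "\<lambda>a. _ * a"] cong: if_cong)
    then have "(G i j t)\<^sup>2 \<le> G i i t * G j j t"
      using cauchy_schwarz_psd_form[of J "\<lambda>i j. G i j t" "?d i" "?d j"] sym psd t ij by simp
    also have "\<dots> = (y i * y j)\<^sup>2" using diag ij t by (simp add: power_mult_distrib)
    finally show ?thesis
      by (rule power2_le_imp_le) (use y_pos[OF ij(1)] y_pos[OF ij(2)] in simp)
  qed
  then have "norm_sum_sq t \<le> (\<Sum>i\<in>J. \<Sum>j\<in>J. y i * y j)" unfolding norm_sum_sq_def by (intro sum_mono)
  also have "\<dots> = (\<Sum>j\<in>J. y j)\<^sup>2" by (simp add: power2_eq_square sum_product)
  finally show ?thesis by (intro real_le_lsqrt sum_nonneg less_imp_le[OF y_pos]) auto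
qed

text \<open>
  This is the argument of Riesz and Thorin between \<open>\<ell>\<^sup>1 \<rightarrow> L\<^sup>\<infinity>\<close> at \<open>Re z = 0\<close> and \<open>\<ell>\<^sup>2 \<rightarrow> L\<^sup>2\<close> at
  \<open>Re z = 1\<close>. Let \<open>q = 2r\<close>, let \<open>p\<close> be its conjugate exponent, \<open>V = \<Sigma> \<Delta>\<^sub>j\<close> and \<open>U = |V|\<^sup>2 + \<epsilon>\<close>. The
  analytic family pairs the vectors with coefficients \<open>y\<^sub>j\<^bsup>p(1 - z/2)\<^esup>\<close>, that is
  \<open>\<Sigma>\<^sub>j y\<^sub>j\<^bsup>p(1 - z/2)\<^esup> \<Delta>\<^sub>j / y\<^sub>j\<close>, with the dual function \<open>U\<^bsup>r - 1/2 - zr/2\<^esup> V\<close>. At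
  \<open>z = 1/r\<close> the coefficients are \<open>y\<^sub>j\<close> and the pairing is \<open>\<integral> U\<^bsup>r-1\<^esup> |V|\<^sup>2\<close>. On the two boundary lines
  it is at most \<open>S I\<close> and \<open>(S I)\<^bsup>1/2\<^esup>\<close>, where \<open>S = \<Sigma> y\<^sub>j\<^bsup>p\<^esup>\<close> and \<open>I = \<integral> U\<^bsup>r\<^esup>\<close>. The shift by \<open>\<epsilon>\<close> keeps \<open>U\<close>
  away from \<open>0\<close>, so that its complex powers are entire in the exponent.
\<close>

lemma gram_hausdorff_young_shifted:
  fixes r \<epsilon> :: real
  defines "S \<equiv> \<Sum>j\<in>J. y j powr (2 * r / (2 * r - 1))"
  assumes "J \<noteq> {}" and r: "r > 1" and eps: "\<epsilon> > 0"
  shows "integral {0..1} (\<lambda>t. (norm_sum_sq t + \<epsilon>) powr (r - 1) * norm_sum_sq t)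
    \<le> (S * integral {0..1} (\<lambda>t. (norm_sum_sq t + \<epsilon>) powr r)) powr (1 - 1 / (2 * r))"
proof -
  define p where "p = 2 * r / (2 * r - 1)"
  \<comment> \<open>\<open>R j t\<close> is the inner product of \<open>\<Delta>\<^sub>j\<close> with \<open>V\<close>, and \<open>Q x t\<close> is \<open>|\<Sigma> x\<^sub>j \<Delta>\<^sub>j|\<^sup>2\<close>.\<close>
  define Q where "Q x t = (\<Sum>i\<in>J. \<Sum>j\<in>J. x i * x j * G i j t)" for x t
  define R where "R j t = (\<Sum>i\<in>J. G j i t)" for j t
  define U where "U t = norm_sum_sq t + \<epsilon>" for t
  define I where "I = integral {0..1} (\<lambda>t. U t powr r)"
  define K where "K = ln (S * I)"
  define C where "C j z = exp ((of_real p * (1 - z / 2) - 1) * of_real (ln (y j)))" for j and z :: complex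
  define \<gamma> where "\<gamma> z = of_real (r - 1 / 2) - z * of_real (r / 2)" for z :: complex
  define F where "F z t = (\<Sum>j\<in>J. C j z * (exp (\<gamma> z * of_real (ln (U t))) * of_real (R j t)))"
    for z and t :: real
  \<comment> \<open>The factor \<open>(S I)\<^bsup>-(1 - z/2)\<^esup>\<close> normalizes both boundary bounds to \<open>1\<close>.\<close>
  define \<Phi> where "\<Phi> z = exp (- (1 - z / 2) * of_real K) * integral {0..1} (F z)" for z

  have p: "1 < p" "p < 2" "p * (1 - 1 / (2 * r)) = 1"
    using r by (auto simp: p_def field_simps)
  have U_pos: "0 < U t" if "t \<in> {0..1}" for t
    using norm_sum_sq_nonneg[OF that] eps by (simp add: U_def)
  note cont_u = continuous_on_norm_sum_sq
  have cont_U: "continuous_on {0..1} U"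
    unfolding U_def by (intro continuous_intros cont_u)
  have cont_R: "continuous_on {0..1} (R j)" if "j \<in> J" for j
    unfolding R_def by (intro continuous_on_sum cont that)
  have cont_lnU: "continuous_on {0..1} (\<lambda>t. ln (U t))"
    using U_pos by (intro continuous_intros cont_U) force
  have cont_Ur: "continuous_on {0..1} (\<lambda>t. U t powr a)" for a
    using U_pos by (intro continuous_intros cont_U) force
  have cont_F: "continuous_on {0..1} (F z)" for z
    unfolding F_def by (intro continuous_intros cont_R cont_lnU)
  have u_R: "(\<Sum>j\<in>J. R j t) = norm_sum_sq t" for t by (simp add: norm_sum_sq_def R_def)

  have cs: "(\<Sum>j\<in>J. x j * R j t)\<^sup>2 \<le> Q x t * norm_sum_sq t" if "t \<in> {0..1}" for x t
    using cauchy_schwarz_psd_form[of J "\<lambda>i j. G i j t" x "\<lambda>_. 1"] sym psd that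
    by (simp add: R_def Q_def norm_sum_sq_def sum_distrib_left)
  have R_bound: "\<bar>R j t\<bar> \<le> y j * sqrt (norm_sum_sq t)" if j: "j \<in> J" and t: "t \<in> {0..1}" for j t
  proof -
    let ?x = "\<lambda>i. if i = j then 1 else 0 :: real"
    have "(\<Sum>i\<in>J. ?x i * R i t) = R j t" using J j by (simp add: if_distrib[of "\<lambda>a. a * _"] cong: if_cong)
    moreover have "Q ?x t = G j j t"
      using J j unfolding Q_def by (simp add: if_distrib[of "\<lambda>a. a * _"] if_distrib[of "\<lambda>a. _ * a"] cong: if_cong)
    ultimately have "(R j t)\<^sup>2 \<le> (y j)\<^sup>2 * norm_sum_sq t" using cs[OF t, of ?x] diag[OF j t] by simp
    then have "sqrt ((R j t)\<^sup>2) \<le> sqrt ((y j)\<^sup>2 * norm_sum_sq t)" by (rule real_sqrt_le_mono)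
    then show ?thesis using y_pos[OF j] by (simp add: real_sqrt_mult)
  qed
  have int_Q: "(Q x has_integral (\<Sum>j\<in>J. (x j)\<^sup>2 * (y j)\<^sup>2)) {0..1}" for x
  proof -
    have "(G i j has_integral (if i = j then (y j)\<^sup>2 else 0)) {0..1}" if "i \<in> J" "j \<in> J" for i j
    proof (cases "i = j")
      case True
      have "((\<lambda>t. (y j)\<^sup>2) has_integral (y j)\<^sup>2) {0..1::real}"
        using has_integral_const_real[of "(y j)\<^sup>2" 0 1] by simp
      then have "(G j j has_integral (y j)\<^sup>2) {0..1}"
        by (rule has_integral_eq[rotated]) (simp add: diag that)
      then show ?thesis using True by simp
    qed (use orth that in auto)
    then have "(Q x has_integral (\<Sum>i\<in>J. \<Sum>j\<in>J. x i * x j * (if i = j then (y j)\<^sup>2 else 0))) {0..1}"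
      unfolding Q_def by (intro has_integral_sum has_integral_mult_right J) auto
    moreover have "(\<Sum>i\<in>J. \<Sum>j\<in>J. x i * x j * (if i = j then (y j)\<^sup>2 else 0)) = (\<Sum>j\<in>J. (x j)\<^sup>2 * (y j)\<^sup>2)"
      using J by (simp add: if_distrib[of "\<lambda>a. _ * a"] power2_eq_square cong: if_cong)
    ultimately show ?thesis by simp
  qed

  have S_pos: "0 < S"
    unfolding S_def using J \<open>J \<noteq> {}\<close> y_pos by (intro sum_pos) force+
  have int_Ur: "((\<lambda>t. U t powr r) has_integral I) {0..1}"
    unfolding I_def by (intro integrable_integral integrable_continuous_real cont_Ur)
  have "((\<lambda>t. \<epsilon> powr r) has_integral \<epsilon> powr r) {0..1::real}"
    using has_integral_const_real[of "\<epsilon> powr r" 0 1] by simp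
  moreover have "\<epsilon> powr r \<le> U t powr r" if "t \<in> {0..1}" for t
    using norm_sum_sq_nonneg[OF that] eps r unfolding U_def by (intro powr_mono2) linarith+
  ultimately have "\<epsilon> powr r \<le> I"
    using has_integral_le int_Ur by blast
  moreover have "0 < \<epsilon> powr r" using eps by simp
  ultimately have I_pos: "0 < I" by linarith
  have exp_K: "exp K = S * I" using S_pos I_pos by (simp add: K_def)

  have norm_C: "cmod (C j z) = y j powr (p * (1 - Re z / 2) - 1)" if "j \<in> J" for j z
    using y_pos[OF that] by (simp add: C_def powr_def)
  have norm_F: "cmod (F z t) = U t powr (r - 1 / 2 - Re z * (r / 2)) * cmod (\<Sum>j\<in>J. C j z * of_real (R j t))"
    if "t \<in> {0..1}" for z t
  proof -
    have "F z t = exp (\<gamma> z * of_real (ln (U t))) * (\<Sum>j\<in>J. C j z * of_real (R j t))"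
      by (simp add: F_def sum_distrib_left mult_ac)
    then show ?thesis using U_pos[OF that] by (simp add: norm_mult \<gamma>_def powr_def)
  qed
  have norm_\<Phi>: "cmod (\<Phi> z) \<le> exp (- (1 - Re z / 2) * K) * b"
    if "(h has_integral b) {0..1}" "\<And>t. t \<in> {0..1} \<Longrightarrow> cmod (F z t) \<le> h t" for z h b
  proof -
    have "cmod (integral {0..1} (F z)) \<le> integral {0..1} h"
      by (rule integral_norm_bound_integral[OF integrable_continuous_real[OF cont_F]
            has_integral_integrable[OF that(1)] that(2)])
    also have "integral {0..1} h = b" using that(1) by (rule integral_unique)
    finally show ?thesis by (simp add: \<Phi>_def norm_mult)
  qed

  define h where "h t = exp (r * \<bar>ln (U t)\<bar>) * (\<Sum>j\<in>J. exp \<bar>ln (y j)\<bar> * \<bar>R j t\<bar>)" for t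
  have "cmod (\<Phi> (of_real (1 / r))) \<le> 1"
  proof (rule three_lines[where f = \<Phi> and B = "exp \<bar>K\<bar> * integral {0..1} h"])
    have hol: "(\<lambda>z. integral (cbox 0 1) (\<lambda>t. exp (\<gamma> z * of_real (ln (U t))) * complex_of_real (R j t)))
        holomorphic_on UNIV" if "j \<in> J" for j
    proof (rule leibniz_rule_holomorphic)
      show "((\<lambda>z. exp (\<gamma> z * of_real (ln (U t))) * complex_of_real (R j t)) has_field_derivative
          (- of_real (r / 2) * of_real (ln (U t))) * exp (\<gamma> z * of_real (ln (U t))) * of_real (R j t))
          (at z within UNIV)" for z t
        unfolding \<gamma>_def by (auto intro!: derivative_eq_intros)
      show "(\<lambda>t. exp (\<gamma> z * of_real (ln (U t))) * complex_of_real (R j t)) integrable_on cbox 0 1" for z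
        unfolding cbox_interval
        by (intro integrable_continuous_real continuous_intros cont_R cont_lnU that)
      have 1: "continuous_on (UNIV \<times> {0..1}) (\<lambda>x :: complex \<times> real. R j (snd x))"
        by (rule continuous_on_compose2[OF cont_R[OF that] continuous_on_snd]) (auto intro: continuous_on_id)
      have 2: "continuous_on (UNIV \<times> {0..1}) (\<lambda>x :: complex \<times> real. ln (U (snd x)))"
        by (rule continuous_on_compose2[OF cont_lnU continuous_on_snd]) (auto intro: continuous_on_id)
      show "continuous_on (UNIV \<times> cbox 0 1) (\<lambda>(z, t). (- of_real (r / 2) * of_real (ln (U t)))
          * exp (\<gamma> z * of_real (ln (U t))) * complex_of_real (R j t))"
        unfolding cbox_interval case_prod_beta \<gamma>_def by (intro continuous_intros 1 2)
    qed simp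
    have "integral {0..1} (F z) = (\<Sum>j\<in>J. C j z * integral (cbox 0 1)
        (\<lambda>t. exp (\<gamma> z * of_real (ln (U t))) * complex_of_real (R j t)))" for z
      unfolding F_def cbox_interval
      by (subst integral_sum)
        (auto intro!: J integrable_continuous_real continuous_intros cont_R cont_lnU)
    then have \<Phi>_eq: "\<Phi> = (\<lambda>z. exp (- (1 - z / 2) * of_real K) * (\<Sum>j\<in>J. C j z * integral (cbox 0 1)
        (\<lambda>t. exp (\<gamma> z * of_real (ln (U t))) * complex_of_real (R j t))))"
      by (simp only: \<Phi>_def fun_eq_iff simp_thms)
    show "\<Phi> holomorphic_on UNIV"
      unfolding \<Phi>_eq C_def by (intro holomorphic_intros hol) auto
  next
    fix z :: complex assume z: "0 \<le> Re z" "Re z \<le> 1"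
    have "(h has_integral integral {0..1} h) {0..1}"
      unfolding h_def
      by (intro integrable_integral integrable_continuous_real continuous_intros cont_R cont_lnU)
    then have "cmod (\<Phi> z) \<le> exp (- (1 - Re z / 2) * K) * integral {0..1} h"
    proof (rule norm_\<Phi>)
      fix t :: real assume t: "t \<in> {0..1}"
      have "cmod (C j z) \<le> exp \<bar>ln (y j)\<bar>" if "j \<in> J" for j
      proof -
        have "0 \<le> p * (1 - Re z / 2)" "p * (1 - Re z / 2) \<le> 2 * 1"
          using z p by (intro mult_nonneg_nonneg mult_mono; simp)+
        then have "\<bar>p * (1 - Re z / 2) - 1\<bar> * \<bar>ln (y j)\<bar> \<le> 1 * \<bar>ln (y j)\<bar>"
          by (intro mult_right_mono) auto
        then have "(p * (1 - Re z / 2) - 1) * ln (y j) \<le> \<bar>ln (y j)\<bar>"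
          unfolding abs_mult[symmetric] by linarith
        then show ?thesis using y_pos[OF that] by (simp add: norm_C[OF that] powr_def)
      qed
      then have "cmod (\<Sum>j\<in>J. C j z * of_real (R j t)) \<le> (\<Sum>j\<in>J. exp \<bar>ln (y j)\<bar> * \<bar>R j t\<bar>)"
        by (intro sum_norm_le) (simp add: norm_mult mult_right_mono)
      moreover have "U t powr (r - 1 / 2 - Re z * (r / 2)) \<le> exp (r * \<bar>ln (U t)\<bar>)"
      proof -
        have "0 \<le> Re z * (r / 2)" "Re z * (r / 2) \<le> 1 * (r / 2)"
          using z r by (intro mult_nonneg_nonneg mult_mono; simp)+
        then have "\<bar>r - 1 / 2 - Re z * (r / 2)\<bar> \<le> r" using r by linarith
        then have "\<bar>r - 1 / 2 - Re z * (r / 2)\<bar> * \<bar>ln (U t)\<bar> \<le> r * \<bar>ln (U t)\<bar>"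
          by (intro mult_right_mono) auto
        then have "(r - 1 / 2 - Re z * (r / 2)) * ln (U t) \<le> r * \<bar>ln (U t)\<bar>"
          unfolding abs_mult[symmetric] by linarith
        then show ?thesis using U_pos[OF t] by (simp add: powr_def)
      qed
      ultimately show "cmod (F z t) \<le> h t"
        unfolding norm_F[OF t] h_def by (intro mult_mono) auto
    qed
    also have "\<dots> \<le> exp \<bar>K\<bar> * integral {0..1} h"
    proof (rule mult_right_mono)
      have "\<bar>1 - Re z / 2\<bar> * \<bar>K\<bar> \<le> 1 * \<bar>K\<bar>" using z by (intro mult_right_mono) auto
      then have "- (1 - Re z / 2) * K \<le> \<bar>K\<bar>" unfolding abs_mult[symmetric] by linarith
      then show "exp (- (1 - Re z / 2) * K) \<le> exp \<bar>K\<bar>" by simp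
      show "0 \<le> integral {0..1} h"
        unfolding h_def
        by (intro integral_nonneg integrable_continuous_real continuous_intros cont_R cont_lnU)
          (auto intro!: mult_nonneg_nonneg sum_nonneg)
    qed
    finally show "cmod (\<Phi> z) \<le> exp \<bar>K\<bar> * integral {0..1} h" .
  next
    fix z :: complex assume z: "Re z = 0"
    have "((\<lambda>t. S * U t powr r) has_integral S * I) {0..1}"
      by (rule has_integral_mult_right[OF int_Ur])
    then have "cmod (\<Phi> z) \<le> exp (- (1 - Re z / 2) * K) * (S * I)"
    proof (rule norm_\<Phi>)
      fix t :: real assume t: "t \<in> {0..1}"
      have "cmod (\<Sum>j\<in>J. C j z * of_real (R j t)) \<le> (\<Sum>j\<in>J. y j powr p * sqrt (norm_sum_sq t))"
      proof (rule sum_norm_le)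
        fix j assume j: "j \<in> J"
        have "cmod (C j z * of_real (R j t)) \<le> y j powr (p - 1) * (y j * sqrt (norm_sum_sq t))"
          using R_bound[OF j t] by (simp add: norm_mult norm_C[OF j] z mult_left_mono)
        also have "\<dots> = y j powr p * sqrt (norm_sum_sq t)"
          using y_pos[OF j] by (simp add: powr_diff)
        finally show "cmod (C j z * of_real (R j t)) \<le> y j powr p * sqrt (norm_sum_sq t)" .
      qed
      also have "\<dots> = S * sqrt (norm_sum_sq t)" by (simp add: S_def p_def sum_distrib_right)
      also have "\<dots> \<le> S * sqrt (U t)" using S_pos eps by (simp add: U_def)
      finally have "cmod (F z t) \<le> U t powr (r - 1 / 2) * (S * sqrt (U t))"
        unfolding norm_F[OF t] z by (simp add: mult_left_mono)
      also have "\<dots> = S * (U t powr (r - 1 / 2) * U t powr (1 / 2))"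
        using U_pos[OF t] by (simp add: powr_half_sqrt)
      also have "\<dots> = S * U t powr r" by (simp flip: powr_add)
      finally show "cmod (F z t) \<le> S * U t powr r" .
    qed
    then show "cmod (\<Phi> z) \<le> 1" using S_pos I_pos by (simp add: z exp_minus exp_K field_simps)
  next
    fix z :: complex assume z: "Re z = 1"
    define m where "m = sqrt (S / I)"
    \<comment> \<open>The weight for which the arithmetic-geometric mean inequality below integrates to \<open>(S I)\<^bsup>1/2\<^esup>\<close>.\<close>
    have m: "m > 0" "m * I = sqrt (S * I)" "S / m = sqrt (S * I)"
    proof -
      define a b where "a = sqrt S" and "b = sqrt I"
      have ab: "a > 0" "b > 0" "S = a * a" "I = b * b" using S_pos I_pos by (auto simp: a_def b_def)
      have "m = a / b" "sqrt (S * I) = a * b"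
        by (simp_all add: m_def a_def b_def real_sqrt_divide real_sqrt_mult)
      then show "m > 0" "m * I = sqrt (S * I)" "S / m = sqrt (S * I)" using ab by simp_all
    qed
    \<comment> \<open>The squared length of the complex combination \<open>\<Sigma> C\<^sub>j \<Delta>\<^sub>j\<close> in the complexified Hilbert space.
        Orthogonality in the mean makes its integral equal to \<open>S\<close>.\<close>
    define W where "W t = Q (\<lambda>j. Re (C j z)) t + Q (\<lambda>j. Im (C j z)) t" for t
    have W_nonneg: "0 \<le> W t" if "t \<in> {0..1}" for t
      using psd[OF that] by (simp add: W_def Q_def)
    have "(\<Sum>j\<in>J. (Re (C j z))\<^sup>2 * (y j)\<^sup>2) + (\<Sum>j\<in>J. (Im (C j z))\<^sup>2 * (y j)\<^sup>2)
        = (\<Sum>j\<in>J. (cmod (C j z))\<^sup>2 * (y j)\<^sup>2)"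
      by (simp add: cmod_power2 algebra_simps flip: sum.distrib)
    also have "\<dots> = S"
      unfolding S_def
    proof (rule sum.cong[OF refl])
      fix j assume j: "j \<in> J"
      have "(cmod (C j z))\<^sup>2 * (y j)\<^sup>2 = (y j powr (p / 2 - 1) * y j powr 1)\<^sup>2"
        using y_pos[OF j] by (simp add: norm_C[OF j] z power_mult_distrib)
      also have "\<dots> = (y j powr (p / 2))\<^sup>2"
        unfolding powr_add[symmetric] by simp
      also have "\<dots> = y j powr p"
        unfolding power2_eq_square powr_add[symmetric] by simp
      finally show "(cmod (C j z))\<^sup>2 * (y j)\<^sup>2 = y j powr (2 * r / (2 * r - 1))"
        by (simp add: p_def)
    qed
    finally have S: "(\<Sum>j\<in>J. (Re (C j z))\<^sup>2 * (y j)\<^sup>2) + (\<Sum>j\<in>J. (Im (C j z))\<^sup>2 * (y j)\<^sup>2) = S" .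
    have "(W has_integral S) {0..1}"
      unfolding W_def[abs_def] S[symmetric] by (intro has_integral_add int_Q)
    then have "((\<lambda>t. (m * U t powr r + W t / m) / 2) has_integral (m * I + S / m) / 2) {0..1}"
      by (intro has_integral_divide has_integral_add has_integral_mult_right int_Ur)
    then have "cmod (\<Phi> z) \<le> exp (- (1 - Re z / 2) * K) * ((m * I + S / m) / 2)"
    proof (rule norm_\<Phi>)
      fix t :: real assume t: "t \<in> {0..1}"
      have exponent: "r - 1 / 2 - 1 * (r / 2) = (r - 1) / 2" by (simp add: field_simps)
      have "(cmod (\<Sum>j\<in>J. C j z * of_real (R j t)))\<^sup>2
          = (\<Sum>j\<in>J. Re (C j z) * R j t)\<^sup>2 + (\<Sum>j\<in>J. Im (C j z) * R j t)\<^sup>2"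
        by (simp add: cmod_power2)
      also have "\<dots> \<le> W t * norm_sum_sq t"
        using cs[OF t, of "\<lambda>j. Re (C j z)"] cs[OF t, of "\<lambda>j. Im (C j z)"]
        by (simp add: W_def distrib_right)
      also have "\<dots> \<le> W t * U t"
        using W_nonneg[OF t] eps by (simp add: U_def mult_left_mono)
      finally have "cmod (\<Sum>j\<in>J. C j z * of_real (R j t)) \<le> sqrt (W t * U t)"
        by (rule real_le_rsqrt)
      then have "cmod (F z t) \<le> U t powr ((r - 1) / 2) * sqrt (W t * U t)"
        unfolding norm_F[OF t] z exponent by (intro mult_left_mono) auto
      also have "\<dots> = (U t powr ((r - 1) / 2) * U t powr (1 / 2)) * sqrt (W t)"
        using U_pos[OF t] by (simp add: powr_half_sqrt real_sqrt_mult)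
      also have "U t powr ((r - 1) / 2) * U t powr (1 / 2) = U t powr (r / 2)"
        by (simp flip: powr_add add: field_simps)
      also have "U t powr (r / 2) * sqrt (W t) = sqrt ((m * U t powr r) * (W t / m))"
        using m U_pos[OF t] by (simp add: real_sqrt_mult powr_powr flip: powr_half_sqrt)
      also have "\<dots> \<le> (m * U t powr r + W t / m) / 2"
        using m W_nonneg[OF t] by (intro arith_geo_mean_sqrt) auto
      finally show "cmod (F z t) \<le> (m * U t powr r + W t / m) / 2" .
    qed
    also have "(m * I + S / m) / 2 = exp (K / 2)"
    proof -
      have "exp (K / 2) = sqrt (exp K)"
        by (rule real_sqrt_unique[symmetric]) (simp_all flip: exp_double)
      then show ?thesis using m by (simp add: exp_K)
    qed
    finally show "cmod (\<Phi> z) \<le> 1" by (simp add: z flip: exp_add)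
  qed (use r in auto)
  moreover have "\<Phi> (of_real (1 / r))
      = of_real (exp (- ((1 - 1 / (2 * r)) * K)) * integral {0..1} (\<lambda>t. U t powr (r - 1) * norm_sum_sq t))"
  proof -
    have "C j (of_real (1 / r)) = 1" for j
    proof -
      have "complex_of_real p * (1 - complex_of_real (1 / r) / 2) - 1 = of_real (p * (1 - 1 / (2 * r)) - 1)"
        by simp
      then show ?thesis unfolding C_def p(3) by simp
    qed
    moreover have "exp (\<gamma> (of_real (1 / r)) * of_real (ln (U t))) = of_real (U t powr (r - 1))"
      if "t \<in> {0..1}" for t
    proof -
      have "\<gamma> (of_real (1 / r)) = of_real (r - 1 / 2 - 1 / r * (r / 2))"
        by (simp add: \<gamma>_def)
      also have "r - 1 / 2 - 1 / r * (r / 2) = r - 1" using r by (simp add: field_simps)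
      finally have "\<gamma> (of_real (1 / r)) * of_real (ln (U t)) = of_real ((r - 1) * ln (U t))"
        by simp
      then show ?thesis using U_pos[OF that] by (simp only: exp_of_real) (simp add: powr_def)
    qed
    ultimately have "F (of_real (1 / r)) t = of_real (U t powr (r - 1) * norm_sum_sq t)" if "t \<in> {0..1}" for t
      using that by (simp add: F_def flip: u_R) (simp add: sum_distrib_left)
    then have "integral {0..1} (F (of_real (1 / r))) = integral {0..1} (\<lambda>t. of_real (U t powr (r - 1) * norm_sum_sq t))"
      by (intro integral_cong) auto
    also have "\<dots> = of_real (integral {0..1} (\<lambda>t. U t powr (r - 1) * norm_sum_sq t))"
      by (intro integral_unique has_integral_of_real integrable_integral integrable_continuous_real
        continuous_intros cont_Ur cont_u)
    finally have "integral {0..1} (F (of_real (1 / r)))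
        = of_real (integral {0..1} (\<lambda>t. U t powr (r - 1) * norm_sum_sq t))" .
    moreover have "- (1 - complex_of_real (1 / r) / 2) * of_real K = of_real (- ((1 - 1 / (2 * r)) * K))"
      by (simp add: algebra_simps)
    ultimately show ?thesis by (simp only: \<Phi>_def exp_of_real of_real_mult)
  qed
  ultimately have "exp (- ((1 - 1 / (2 * r)) * K)) * integral {0..1} (\<lambda>t. U t powr (r - 1) * norm_sum_sq t) \<le> 1"
    by (simp only: norm_of_real)
  then have "integral {0..1} (\<lambda>t. U t powr (r - 1) * norm_sum_sq t) \<le> exp ((1 - 1 / (2 * r)) * K)"
    unfolding exp_minus by (simp only: inverse_eq_divide times_divide_eq_left mult_1 divide_le_eq_1_pos exp_gt_zero)
  also have "\<dots> = (S * I) powr (1 - 1 / (2 * r))"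
    using S_pos I_pos by (simp add: powr_def K_def)
  finally show ?thesis by (simp add: U_def I_def)
qed

text \<open>
  As \<open>\<epsilon> \<rightarrow> 0\<close>, the bound with the shift becomes \<open>I \<le> (S I)\<^bsup>1/p\<^esup>\<close> for \<open>I = \<integral> |V|\<^bsup>q\<^esup>\<close>, and dividing by
  \<open>I\<^bsup>1/p\<^esup>\<close> leaves \<open>I\<^bsup>1/q\<^esup> \<le> S\<^bsup>1/p\<^esup>\<close>. Here \<open>q = 2r\<close> and \<open>q/p = 2r - 1\<close>.
\<close>

lemma gram_hausdorff_young:
  assumes r: "r > 1"
  shows "integral {0..1} (\<lambda>t. norm_sum_sq t powr r)
    \<le> (\<Sum>j\<in>J. y j powr (2 * r / (2 * r - 1))) powr (2 * r - 1)"
proof (cases "J = {}")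
  case True
  then show ?thesis unfolding norm_sum_sq_def using r by (simp add: True)
next
  case False
  define S where "S = (\<Sum>j\<in>J. y j powr (2 * r / (2 * r - 1)))"
  define I where "I \<epsilon> = integral {0..1} (\<lambda>t. (norm_sum_sq t + \<epsilon>) powr r)" for \<epsilon>
  have nonneg: "0 \<le> norm_sum_sq t" if "t \<in> {0..1}" for t by (rule norm_sum_sq_nonneg[OF that])
  have int: "(\<lambda>t. (norm_sum_sq t + \<epsilon>) powr s) integrable_on {0..1}" if "0 \<le> \<epsilon>" "0 < s" for \<epsilon> s
    using nonneg that
    by (intro integrable_continuous_real continuous_on_powr' continuous_on_add continuous_on_mult
        continuous_on_const continuous_on_norm_sum_sq)
      (auto intro: add_nonneg_nonneg)
  have "continuous_on ({0..1} \<times> {0..1}) (\<lambda>x. norm_sum_sq (snd x))"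
    by (rule continuous_on_compose2[OF continuous_on_norm_sum_sq continuous_on_snd]) (auto intro: continuous_on_id)
  then have cont: "continuous_on ({0..1} \<times> {0..1}) (\<lambda>x. (norm_sum_sq (snd x) + fst x) powr r)"
  proof (intro continuous_on_powr' continuous_on_add continuous_on_const continuous_on_fst
      continuous_on_id ballI)
    fix x :: "real \<times> real" assume "x \<in> {0..1} \<times> {0..1}"
    then have "0 \<le> norm_sum_sq (snd x)" "0 \<le> fst x" using nonneg by auto
    then show "0 \<le> norm_sum_sq (snd x) + fst x \<and> (norm_sum_sq (snd x) + fst x = 0 \<longrightarrow> 0 < r)" using r by simp
  qed
  have "continuous_on {0..1} (\<lambda>\<epsilon>. integral (cbox 0 1) (\<lambda>t. (norm_sum_sq t + \<epsilon>) powr r))"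
    by (rule integral_continuous_on_param) (use cont in \<open>simp add: case_prod_unfold\<close>)
  then have "continuous_on {0..1} I" by (simp add: I_def[abs_def])
  then have "(I \<longlongrightarrow> I 0) (at 0 within {0..1})"
    by (simp add: continuous_on_def)
  then have tends: "((\<lambda>\<epsilon>. S * I \<epsilon>) \<longlongrightarrow> S * I 0) (at 0 within {0..1})"
    by (intro tendsto_mult tendsto_const)
  have "0 \<le> S * I \<epsilon>" if "0 \<le> \<epsilon>" for \<epsilon>
    unfolding S_def I_def using int[OF that, of r] r
    by (intro mult_nonneg_nonneg sum_nonneg integral_nonneg) auto
  then have "\<forall>\<^sub>F \<epsilon> in at 0 within {0..1}. 0 \<le> S * I \<epsilon>"
    by (simp add: eventually_at_filter)
  then have lim: "((\<lambda>\<epsilon>. (S * I \<epsilon>) powr (1 - 1 / (2 * r))) \<longlongrightarrow> (S * I 0) powr (1 - 1 / (2 * r)))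
      (at 0 within {0..1})"
    using r by (intro tendsto_powr'[OF tends tendsto_const] disjI2 conjI) (simp_all add: field_simps)
  have "I 0 \<le> (S * I \<epsilon>) powr (1 - 1 / (2 * r))" if \<epsilon>: "\<epsilon> > 0" for \<epsilon>
  proof -
    have "I 0 \<le> integral {0..1} (\<lambda>t. (norm_sum_sq t + \<epsilon>) powr (r - 1) * norm_sum_sq t)"
      unfolding I_def
    proof (rule integral_le)
      show "(\<lambda>t. (norm_sum_sq t + 0) powr r) integrable_on {0..1}" using int[of 0 r] r by simp
      show "(\<lambda>t. (norm_sum_sq t + \<epsilon>) powr (r - 1) * norm_sum_sq t) integrable_on {0..1}"
        using nonneg \<epsilon> r
        by (intro integrable_continuous_real continuous_on_powr' continuous_on_add continuous_on_mult
        continuous_on_const continuous_on_norm_sum_sq)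
          (auto intro: add_nonneg_nonneg)
      fix t :: real assume t: "t \<in> {0..1}"
      have "norm_sum_sq t powr r = norm_sum_sq t powr (r - 1) * norm_sum_sq t"
        using nonneg[OF t] by (cases "norm_sum_sq t = 0") (auto simp: powr_diff)
      also have "\<dots> \<le> (norm_sum_sq t + \<epsilon>) powr (r - 1) * norm_sum_sq t"
        using nonneg[OF t] \<epsilon> r by (intro mult_right_mono powr_mono2) auto
      finally show "(norm_sum_sq t + 0) powr r \<le> (norm_sum_sq t + \<epsilon>) powr (r - 1) * norm_sum_sq t" by simp
    qed
    also have "\<dots> \<le> (S * I \<epsilon>) powr (1 - 1 / (2 * r))"
      unfolding S_def I_def by (rule gram_hausdorff_young_shifted[OF False r \<epsilon>])
    finally show ?thesis .
  qed
  then have "\<forall>\<^sub>F \<epsilon> in at 0 within {0..1}. I 0 \<le> (S * I \<epsilon>) powr (1 - 1 / (2 * r))"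
    by (auto simp: eventually_at_filter)
  then have le: "I 0 \<le> (S * I 0) powr (1 - 1 / (2 * r))"
    using tendsto_lowerbound[OF lim] by (simp add: at_within_Icc_at_right)
  have "I 0 \<le> S powr (2 * r - 1)"
  proof (cases "I 0 > 0")
    case True
    have S: "0 \<le> S" by (simp add: S_def sum_nonneg)
    let ?s = "1 - 1 / (2 * r)"
    have "I 0 powr (1 / (2 * r)) * I 0 powr ?s \<le> S powr ?s * I 0 powr ?s"
      using le True S by (simp add: powr_mult flip: powr_add)
    then have "I 0 powr (1 / (2 * r)) \<le> S powr ?s" using True by simp
    then have "(I 0 powr (1 / (2 * r))) powr (2 * r) \<le> (S powr ?s) powr (2 * r)"
      using r by (intro powr_mono2) auto
    then show ?thesis using r True by (simp add: powr_powr left_diff_distrib)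
  next
    case False
    then show ?thesis by (meson linorder_not_less order_trans powr_ge_zero)
  qed
  then show ?thesis by (simp add: I_def S_def)
qed

end

section \<open>Products of the factors and their holomorphic extension\<close>

definition character :: "int \<Rightarrow> real \<Rightarrow> complex" where
  "character n t = exp (2 * of_real pi * \<i> * of_int n * of_real t)"

lemma character_simps [simp]:
  "character 0 t = 1" "cmod (character n t) = 1" "cnj (character n t) = character (- n) t"
  by (simp_all add: character_def exp_cnj)

lemma character_add: "character (m + n) t = character m t * character n t"
  by (simp add: character_def exp_add[symmetric] algebra_simps)

lemma character_cancel: "character (- n) t * character (1 + n) t = character 1 t"
  by (simp add: character_add[symmetric])

lemma character_of_nat: "character (int n) t = character 1 t ^ n"
  by (induction n) (simp_all add: character_add)

text \<open>
  The first row of the product over an arbitrary list of indices. The proof compares the whole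
  product with its prefixes and with the blocks between two prefixes.
\<close>

definition partial_a :: "(int \<Rightarrow> complex) \<Rightarrow> int list \<Rightarrow> real \<Rightarrow> complex" where
  "partial_a F xs t = foldr (\<lambda>n P. nlft_factor F t n ** P) xs (mat 1) $ 1 $ 1"

definition partial_b :: "(int \<Rightarrow> complex) \<Rightarrow> int list \<Rightarrow> real \<Rightarrow> complex" where
  "partial_b F xs t = foldr (\<lambda>n P. nlft_factor F t n ** P) xs (mat 1) $ 1 $ 2"

lemma second_row:
  fixes F t
  defines "P \<equiv> \<lambda>xs. foldr (\<lambda>n P. nlft_factor F t n ** P) xs (mat 1)"
  shows "P xs $ 2 $ 1 = cnj (partial_b F xs t)" "P xs $ 2 $ 2 = cnj (partial_a F xs t)"
  unfolding P_def partial_a_def partial_b_def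
  by (induction xs)
    (simp_all add: mat_def matrix_matrix_mult_def sum_2 nlft_factor_entries del: exp_cnj)

lemma partial_Nil [simp]: "partial_a F [] t = 1" "partial_b F [] t = 0"
  by (simp_all add: partial_a_def partial_b_def mat_def)

lemma partial_Cons:
  "partial_a F (n # xs) t = of_real (nlft_A F n) *
    (partial_a F xs t + F n * character n t * cnj (partial_b F xs t))"
  "partial_b F (n # xs) t = of_real (nlft_A F n) *
    (partial_b F xs t + F n * character n t * cnj (partial_a F xs t))"
  using second_row[of F t xs]
  by (simp_all add: partial_a_def partial_b_def matrix_matrix_mult_def sum_2 nlft_factor_entries
      nlft_B_def character_def algebra_simps)

lemma partial_append:
  "partial_a F (xs @ ys) t = partial_a F xs t * partial_a F ys t + partial_b F xs t * cnj (partial_b F ys t)"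
  "partial_b F (xs @ ys) t = partial_a F xs t * partial_b F ys t + partial_b F xs t * cnj (partial_a F ys t)"
  by (induction xs) (simp_all add: partial_Cons algebra_simps)

lemma continuous_on_partial [continuous_intros]:
  "continuous_on T (partial_a F xs)" "continuous_on T (partial_b F xs)"
proof -
  have "continuous_on T (\<lambda>t. partial_a F xs t) \<and> continuous_on T (\<lambda>t. partial_b F xs t)"
    by (induction xs) (auto simp: partial_Cons character_def intro!: continuous_intros)
  then show "continuous_on T (partial_a F xs)" "continuous_on T (partial_b F xs)" by auto
qed

text \<open>
  The indefinite form \<open>|\<alpha>|\<^sup>2 - |\<beta>|\<^sup>2\<close> is preserved up to a scalar by one factor. On the circle this
  gives \<open>|a|\<^sup>2 - |b|\<^sup>2 = 1\<close>; inside the disc it keeps \<open>|\<beta>| < |\<alpha>|\<close>.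
\<close>

lemma cmod_hyperbolic_gap:
  "(cmod (\<alpha> + cnj f * \<beta>))\<^sup>2 - (cmod (\<beta> + f * \<alpha>))\<^sup>2
    = (1 - (cmod f)\<^sup>2) * ((cmod \<alpha>)\<^sup>2 - (cmod \<beta>)\<^sup>2)"
  unfolding cmod_power2 by (simp add: power2_eq_square algebra_simps)

lemma nlft_A_bounds:
  assumes "\<forall>n. cmod (F n) < 1"
  shows "(nlft_A F n)\<^sup>2 * (1 - (cmod (F n))\<^sup>2) = 1" "0 < nlft_A F n" "1 \<le> (nlft_A F n)\<^sup>2"
    "F n \<noteq> 0 \<Longrightarrow> 1 < (nlft_A F n)\<^sup>2"
proof -
  have pos: "0 < 1 - (cmod (F n))\<^sup>2"
    using assms[rule_format, of n] by (simp add: abs_square_less_1)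
  have A2: "(nlft_A F n)\<^sup>2 = 1 / (1 - (cmod (F n))\<^sup>2)"
    using pos by (simp add: nlft_A_def powr_minus_divide powr_half_sqrt power_divide)
  show "(nlft_A F n)\<^sup>2 * (1 - (cmod (F n))\<^sup>2) = 1" using pos by (simp add: A2)
  show "0 < nlft_A F n" using pos by (simp add: nlft_A_def)
  show "1 \<le> (nlft_A F n)\<^sup>2" "F n \<noteq> 0 \<Longrightarrow> 1 < (nlft_A F n)\<^sup>2"
    using pos by (simp_all add: A2)
qed

lemma partial_det:
  assumes "\<forall>n. cmod (F n) < 1"
  shows "(cmod (partial_a F xs t))\<^sup>2 - (cmod (partial_b F xs t))\<^sup>2 = 1"
proof (induction xs)
  case (Cons n xs)
  let ?f = "F n * character n t"
  have "cmod (partial_a F xs t + ?f * cnj (partial_b F xs t))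
      = cmod (cnj (partial_a F xs t) + cnj ?f * partial_b F xs t)"
    by (subst complex_mod_cnj[symmetric]) simp
  then have "(cmod (partial_a F xs t + ?f * cnj (partial_b F xs t)))\<^sup>2
      - (cmod (partial_b F xs t + ?f * cnj (partial_a F xs t)))\<^sup>2 = 1 - (cmod (F n))\<^sup>2"
    using cmod_hyperbolic_gap[of "cnj (partial_a F xs t)" ?f "partial_b F xs t"] Cons
    by (simp add: norm_mult)
  then show ?case
    using nlft_A_bounds(1)[OF assms, of n]
    by (simp only: partial_Cons norm_mult power_mult_distrib right_diff_distrib[symmetric] norm_of_real power2_abs)
qed simp

lemma cmod_partial_a_ge_1:
  assumes "\<forall>n. cmod (F n) < 1"
  shows "1 \<le> (cmod (partial_a F xs t))\<^sup>2" "partial_a F xs t \<noteq> 0"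
proof -
  show 1: "1 \<le> (cmod (partial_a F xs t))\<^sup>2"
    using partial_det[OF assms, where xs = xs and t = t] zero_le_power2[of "cmod (partial_b F xs t)"] by linarith
  then show "partial_a F xs t \<noteq> 0" by auto
qed

text \<open>
  Since the indices increase, the conjugate of \<open>a\<close> is a polynomial in \<open>z = exp (2\<pi>it)\<close>, and so is \<open>b\<close>
  after division by a character whose frequency is a lower bound of the indices. Inside the disc
  the bound \<open>|\<beta>| < |\<alpha>|\<close> survives each new factor by \<open>cmod_hyperbolic_gap\<close>, because \<open>|z| \<le> 1\<close>. In particular \<open>\<alpha>\<close> has no zero there. In the
  induction step \<open>n + 1\<close> is a lower bound of the indices of the tail, which supplies a factor \<open>z\<close> next to
  \<open>\<beta>\<close>; this is the zero at the origin on which the mean value computation rests.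
\<close>

lemma holomorphic_extension:
  assumes F: "\<forall>n. cmod (F n) < 1"
    and "sorted_wrt (<) xs" and "\<forall>n\<in>set xs. k \<le> n"
  shows "\<exists>\<alpha> \<beta>. \<alpha> holomorphic_on UNIV \<and> \<beta> holomorphic_on UNIV
    \<and> (\<forall>z. cmod z \<le> 1 \<longrightarrow> cmod (\<beta> z) < cmod (\<alpha> z))
    \<and> (\<forall>t. cnj (partial_a F xs t) = \<alpha> (character 1 t))
    \<and> (\<forall>t. partial_b F xs t = character k t * \<beta> (character 1 t))"
  using assms(2,3)
proof (induction xs arbitrary: k)
  case Nil
  show ?case by (intro exI[of _ "\<lambda>_. 1"] exI[of _ "\<lambda>_. 0"]) auto
next
  case (Cons n xs)
  from Cons.IH[of "n + 1"] Cons.prems obtain \<alpha> \<beta> where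
    hol: "\<alpha> holomorphic_on UNIV" "\<beta> holomorphic_on UNIV"
    and less: "\<And>z. cmod z \<le> 1 \<Longrightarrow> cmod (\<beta> z) < cmod (\<alpha> z)"
    and a: "\<And>t. cnj (partial_a F xs t) = \<alpha> (character 1 t)"
    and b: "\<And>t. partial_b F xs t = character (n + 1) t * \<beta> (character 1 t)"
    by force
  define m where "m = nat (n - k)"
  have m: "n = k + int m" using Cons.prems by (simp add: m_def)
  define \<alpha>' where "\<alpha>' z = of_real (nlft_A F n) * (\<alpha> z + cnj (F n) * (z * \<beta> z))" for z
  define \<beta>' where "\<beta>' z = z ^ m * (of_real (nlft_A F n) * (z * \<beta> z + F n * \<alpha> z))" for z
  have "\<alpha>' holomorphic_on UNIV" "\<beta>' holomorphic_on UNIV"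
    unfolding \<alpha>'_def[abs_def] \<beta>'_def[abs_def] by (intro holomorphic_intros hol)+
  moreover have "cmod (\<beta>' z) < cmod (\<alpha>' z)" if z: "cmod z \<le> 1" for z
  proof -
    have "cmod (z * \<beta> z) \<le> 1 * cmod (\<beta> z)"
      unfolding norm_mult using z by (intro mult_right_mono) auto
    then have "cmod (z * \<beta> z) < cmod (\<alpha> z)" using less[OF z] by linarith
    then have "(cmod (z * \<beta> z))\<^sup>2 < (cmod (\<alpha> z))\<^sup>2" by (simp add: power_strict_mono)
    moreover have "(cmod (F n))\<^sup>2 < 1" using F[rule_format, of n] by (simp add: abs_square_less_1)
    ultimately have "0 < (1 - (cmod (F n))\<^sup>2) * ((cmod (\<alpha> z))\<^sup>2 - (cmod (z * \<beta> z))\<^sup>2)" by simp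
    then have "(cmod (z * \<beta> z + F n * \<alpha> z))\<^sup>2 < (cmod (\<alpha> z + cnj (F n) * (z * \<beta> z)))\<^sup>2"
      using cmod_hyperbolic_gap[of "\<alpha> z" "F n" "z * \<beta> z"] by linarith
    then have "cmod (z * \<beta> z + F n * \<alpha> z) < cmod (\<alpha> z + cnj (F n) * (z * \<beta> z))"
      by (rule power_less_imp_less_base) simp
    then have "nlft_A F n * cmod (z * \<beta> z + F n * \<alpha> z) < cmod (\<alpha>' z)"
      using nlft_A_bounds(2)[OF F, of n] by (simp add: \<alpha>'_def norm_mult)
    moreover have "cmod (\<beta>' z) \<le> 1 * (nlft_A F n * cmod (z * \<beta> z + F n * \<alpha> z))"
      unfolding \<beta>'_def norm_mult norm_power using z nlft_A_bounds(2)[OF F, of n]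
      by (intro mult_mono power_le_one) auto
    ultimately show ?thesis by simp
  qed
  moreover have "cnj (partial_a F (n # xs) t) = \<alpha>' (character 1 t)" for t
    by (simp add: partial_Cons a b \<alpha>'_def character_cancel mult.assoc)
  moreover have "partial_b F (n # xs) t = character k t * \<beta>' (character 1 t)" for t
    by (simp add: partial_Cons a b \<beta>'_def m character_add character_of_nat algebra_simps)
  ultimately show ?case by blast
qed

text \<open>
  A new factor multiplies the conjugate of \<open>a\<close> by \<open>A\<^sub>n (1 + s(z))\<close>, where \<open>s\<close> is holomorphic,
  \<open>|s| < 1\<close> and \<open>s(0) = 0\<close>. The mean value property applied to the principal logarithm of
  \<open>1 + s\<close> shows that only \<open>A\<^sub>n\<close> contributes to the mean of \<open>log |a|\<^sup>2\<close>.
\<close>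

lemma has_integral_ln_partial_a:
  assumes F: "\<forall>n. cmod (F n) < 1" and "sorted_wrt (<) xs"
  shows "((\<lambda>t. ln ((cmod (partial_a F xs t))\<^sup>2)) has_integral (\<Sum>n\<leftarrow>xs. ln ((nlft_A F n)\<^sup>2))) {0..1}"
  using assms(2)
proof (induction xs)
  case (Cons n xs)
  have A: "nlft_A F n > 0" using nlft_A_bounds(2)[OF F, of n] .
  from Cons.prems holomorphic_extension[OF F, of xs "n + 1"] obtain \<alpha> \<beta> where
    hol: "\<alpha> holomorphic_on UNIV" "\<beta> holomorphic_on UNIV"
    and less: "\<And>z. cmod z \<le> 1 \<Longrightarrow> cmod (\<beta> z) < cmod (\<alpha> z)"
    and a: "\<And>t. cnj (partial_a F xs t) = \<alpha> (character 1 t)"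
    and b: "\<And>t. partial_b F xs t = character (n + 1) t * \<beta> (character 1 t)"
    by force
  define s where "s z = cnj (F n) * (z * \<beta> z / \<alpha> z)" for z
  have \<alpha>_nz: "\<alpha> z \<noteq> 0" if "z \<in> cball 0 1" for z using less[of z] that by auto
  have s_less: "cmod (s z) < 1" if "z \<in> cball 0 1" for z
  proof -
    have "cmod z \<le> 1" using that by simp
    then have "cmod (z * \<beta> z / \<alpha> z) \<le> 1 * 1"
      unfolding norm_mult norm_divide times_divide_eq_right[symmetric]
      using less[of z] by (intro mult_mono) (auto simp: divide_le_eq_1)
    then have "cmod (s z) \<le> cmod (F n) * 1" unfolding s_def norm_mult by (intro mult_mono) auto
    then show ?thesis using F[rule_format, of n] by simp
  qed
  have hol_s: "s holomorphic_on cball 0 1"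
    unfolding s_def[abs_def]
    by (intro holomorphic_intros holomorphic_on_subset[OF hol(1)] holomorphic_on_subset[OF hol(2)])
      (use \<alpha>_nz in auto)
  have "1 + s z \<notin> \<real>\<^sub>\<le>\<^sub>0" if "z \<in> cball 0 1" for z
    using s_less[OF that] abs_Re_le_cmod[of "s z"] by (auto simp: complex_nonpos_Reals_iff)
  then have hol_Ln: "(\<lambda>z. Ln (1 + s z)) holomorphic_on cball 0 1"
    by (intro holomorphic_intros hol_s) auto
  have "((\<lambda>t. Ln (1 + s (exp (2 * of_real pi * \<i> * of_real t)))) has_integral Ln (1 + s 0)) {0..1}"
    by (rule circle_mean_value[of "\<lambda>z. Ln (1 + s z)"])
      (use hol_Ln holomorphic_on_imp_continuous_on holomorphic_on_subset[OF hol_Ln] in auto)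
  then have "((\<lambda>t. Ln (1 + s (character 1 t))) has_integral 0) {0..1}"
    by (simp add: s_def character_def)
  then have "((\<lambda>t. 2 * Re (Ln (1 + s (character 1 t)))) has_integral 2 * Re 0) {0..1}"
    by (intro has_integral_mult_right has_integral_Re)
  moreover have "((\<lambda>t. ln ((nlft_A F n)\<^sup>2)) has_integral ln ((nlft_A F n)\<^sup>2)) {0..1::real}"
    using has_integral_const_real[of "ln ((nlft_A F n)\<^sup>2)" 0 1] by simp
  moreover have "((\<lambda>t. ln ((cmod (partial_a F xs t))\<^sup>2)) has_integral (\<Sum>n\<leftarrow>xs. ln ((nlft_A F n)\<^sup>2))) {0..1}"
    using Cons by simp
  ultimately have "((\<lambda>t. ln ((nlft_A F n)\<^sup>2) + ln ((cmod (partial_a F xs t))\<^sup>2)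
      + 2 * Re (Ln (1 + s (character 1 t)))) has_integral
      ln ((nlft_A F n)\<^sup>2) + (\<Sum>n\<leftarrow>xs. ln ((nlft_A F n)\<^sup>2)) + 2 * Re 0) {0..1}"
    by (intro has_integral_add)
  moreover have "ln ((nlft_A F n)\<^sup>2) + ln ((cmod (partial_a F xs t))\<^sup>2)
      + 2 * Re (Ln (1 + s (character 1 t))) = ln ((cmod (partial_a F (n # xs) t))\<^sup>2)" for t
  proof -
    let ?z = "character 1 t"
    have z: "?z \<in> cball 0 1" by simp
    have nz: "\<alpha> ?z \<noteq> 0" "1 + s ?z \<noteq> 0"
      using \<alpha>_nz[OF z] s_less[OF z] by (auto simp: add_eq_0_iff)
    have "cnj (partial_a F (n # xs) t) = of_real (nlft_A F n) * (\<alpha> ?z + cnj (F n) * (?z * \<beta> ?z))"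
      by (simp add: partial_Cons a b character_cancel mult.assoc)
    also have "\<dots> = of_real (nlft_A F n) * \<alpha> ?z * (1 + s ?z)"
      using nz by (simp add: s_def field_simps)
    finally have "cmod (partial_a F (n # xs) t) = nlft_A F n * cmod (partial_a F xs t) * cmod (1 + s ?z)"
      using A by (metis a abs_of_pos complex_mod_cnj norm_mult norm_of_real)
    moreover have "partial_a F xs t \<noteq> 0" using nz a[of t] by auto
    ultimately show ?thesis
      using A nz by (simp add: power_mult_distrib ln_mult ln_realpow)
  qed
  ultimately show ?case by simp
qed simp

section \<open>The disc as a subset of a Hilbert space\<close>

text \<open>
  The squared distance of \<open>\<Psi>(w)\<close> and \<open>\<Psi>(z)\<close> for the embedding \<open>\<Psi>(w) = (w\<^sup>k / \<surd>k)\<^sub>k\<close> into \<open>\<ell>\<^sup>2\<close>. In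
  terms of the hyperbolic distance \<open>d\<close> it equals \<open>2 log cosh d\<close>, in the normalization where
  \<open>tanh d\<close> is the pseudohyperbolic distance.
\<close>

definition disc_sqdist :: "complex \<Rightarrow> complex \<Rightarrow> real" where
  "disc_sqdist w z = 2 * ln (cmod (1 - w * cnj z)) - ln (1 - (cmod w)\<^sup>2) - ln (1 - (cmod z)\<^sup>2)"

lemma disc_sqdist_self: "cmod w < 1 \<Longrightarrow> disc_sqdist w w = 0"
proof -
  assume w: "cmod w < 1"
  then have "(cmod w)\<^sup>2 < 1" by (simp add: abs_square_less_1)
  moreover have "1 - w * cnj w = of_real (1 - (cmod w)\<^sup>2)" by (simp add: complex_norm_square[symmetric])
  ultimately show ?thesis by (simp only: disc_sqdist_def norm_of_real)
qed

lemma disc_sqdist_commute: "disc_sqdist w z = disc_sqdist z w"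
proof -
  have "cmod (1 - w * cnj z) = cmod (cnj (1 - w * cnj z))" by (rule complex_mod_cnj[symmetric])
  also have "\<dots> = cmod (1 - z * cnj w)" by (simp add: mult.commute)
  finally show ?thesis by (simp add: disc_sqdist_def)
qed

text \<open>
  Polarization: the real inner product of the increments \<open>\<Psi>(q) - \<Psi>(p)\<close> and \<open>\<Psi>(q') - \<Psi>(p')\<close>,
  expressed through distances.
\<close>

definition disc_inner :: "complex \<Rightarrow> complex \<Rightarrow> complex \<Rightarrow> complex \<Rightarrow> real" where
  "disc_inner p q p' q' =
    (disc_sqdist p q' + disc_sqdist q p' - disc_sqdist p p' - disc_sqdist q q') / 2"

lemma one_minus_mult_cnj_nonzero:
  assumes "cmod w < 1" "cmod z < 1"
  shows "cmod (w * cnj z) < 1" "1 - w * cnj z \<noteq> 0"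
proof -
  show 1: "cmod (w * cnj z) < 1"
    using assms mult_strict_mono'[of "cmod w" 1 "cmod z" 1] by (simp add: norm_mult)
  then show "1 - w * cnj z \<noteq> 0" by (metis eq_iff_diff_eq_0 less_irrefl norm_one)
qed

text \<open>
  The inner product computed coordinatewise, from the series \<open>-log (1 - x) = \<Sigma> x\<^sup>k / k\<close> at the
  product of one point with the conjugate of another. The one-point terms of the squared distance
  cancel. The term \<open>k = 0\<close> is zero by division by zero.
\<close>

lemma disc_inner_sums:
  assumes "cmod p < 1" "cmod q < 1" "cmod p' < 1" "cmod q' < 1"
  shows "(\<lambda>k. Re ((q ^ k - p ^ k) * cnj (q' ^ k - p' ^ k)) / real k) sums disc_inner p q p' q'"
proof -
  have kernel: "(\<lambda>k. Re (w ^ k * cnj (z ^ k)) / real k) sums - ln (cmod (1 - w * cnj z))"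
    if "cmod w < 1" "cmod z < 1" for w z
  proof -
    note nz = one_minus_mult_cnj_nonzero[OF that]
    have "(\<lambda>k. - ((w * cnj z) ^ k) / of_nat k) sums Ln (1 + - (w * cnj z))"
      using Ln_series'[of "- (w * cnj z)"] nz(1) by simp
    then have "(\<lambda>k. Re (- ((w * cnj z) ^ k) / of_nat k)) sums Re (Ln (1 + - (w * cnj z)))"
      by (rule sums_Re)
    then have "(\<lambda>k. - Re (- ((w * cnj z) ^ k) / of_nat k)) sums - Re (Ln (1 - w * cnj z))"
      by (intro sums_minus) simp
    then show ?thesis using nz(2) by (simp add: power_mult_distrib Re_divide_of_nat)
  qed
  have "(\<lambda>k. Re (q ^ k * cnj (q' ^ k)) / real k - Re (p ^ k * cnj (q' ^ k)) / real k
      - Re (q ^ k * cnj (p' ^ k)) / real k + Re (p ^ k * cnj (p' ^ k)) / real k) sums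
      (- ln (cmod (1 - q * cnj q')) - - ln (cmod (1 - p * cnj q'))
      - - ln (cmod (1 - q * cnj p')) + - ln (cmod (1 - p * cnj p')))"
    by (intro sums_add sums_diff kernel assms)
  moreover have "\<dots> = disc_inner p q p' q'"
    by (simp add: disc_inner_def disc_sqdist_def field_simps)
  moreover have "Re (q ^ k * cnj (q' ^ k)) / real k - Re (p ^ k * cnj (q' ^ k)) / real k
      - Re (q ^ k * cnj (p' ^ k)) / real k + Re (p ^ k * cnj (p' ^ k)) / real k
    = Re ((q ^ k - p ^ k) * cnj (q' ^ k - p' ^ k)) / real k" for k
    by (simp add: algebra_simps diff_divide_distrib add_divide_distrib)
  ultimately show ?thesis by simp
qed

text \<open>Coordinatewise, the quadratic form is a sum of squares.\<close>

lemma disc_inner_psd: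
  assumes "finite J" and p: "\<And>j. j \<in> J \<Longrightarrow> cmod (p j) < 1" and q: "\<And>j. j \<in> J \<Longrightarrow> cmod (q j) < 1"
  shows "0 \<le> (\<Sum>i\<in>J. \<Sum>j\<in>J. x i * x j * disc_inner (p i) (q i) (p j) (q j))"
proof -
  define e where "e k j = q j ^ k - p j ^ k" for k j
  have "(\<lambda>k. \<Sum>i\<in>J. \<Sum>j\<in>J. x i * x j * (Re (e k i * cnj (e k j)) / real k)) sums
      (\<Sum>i\<in>J. \<Sum>j\<in>J. x i * x j * disc_inner (p i) (q i) (p j) (q j))"
    unfolding e_def by (intro sums_sum sums_mult disc_inner_sums p q)
  moreover have "(\<Sum>i\<in>J. \<Sum>j\<in>J. x i * x j * (Re (e k i * cnj (e k j)) / real k))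
      = (cmod (\<Sum>i\<in>J. of_real (x i) * e k i))\<^sup>2 / real k" for k
  proof -
    have "complex_of_real ((cmod (\<Sum>i\<in>J. of_real (x i) * e k i))\<^sup>2)
        = (\<Sum>i\<in>J. \<Sum>j\<in>J. of_real (x i) * e k i * cnj (of_real (x j) * e k j))"
      by (simp only: complex_norm_square cnj_sum sum_product)
    then have "(cmod (\<Sum>i\<in>J. of_real (x i) * e k i))\<^sup>2
        = Re (\<Sum>i\<in>J. \<Sum>j\<in>J. of_real (x i) * e k i * cnj (of_real (x j) * e k j))"
      by (metis Re_complex_of_real)
    also have "\<dots> = (\<Sum>i\<in>J. \<Sum>j\<in>J. x i * x j * Re (e k i * cnj (e k j)))"
      by (simp add: algebra_simps)
    finally show ?thesis by (simp add: sum_divide_distrib)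
  qed
  ultimately have "(\<lambda>k. (cmod (\<Sum>i\<in>J. of_real (x i) * e k i))\<^sup>2 / real k) sums
      (\<Sum>i\<in>J. \<Sum>j\<in>J. x i * x j * disc_inner (p i) (q i) (p j) (q j))" by simp
  then show ?thesis by (rule sums_le[OF _ sums_zero, rotated]) simp
qed

section \<open>The path of partial products\<close>

text \<open>The image of the origin under the Moebius transformation of the product of the first \<open>i\<close> factors.\<close>

definition orbit :: "(int \<Rightarrow> complex) \<Rightarrow> int list \<Rightarrow> nat \<Rightarrow> real \<Rightarrow> complex" where
  "orbit F xs i t = partial_b F (take i xs) t / cnj (partial_a F (take i xs) t)"

text \<open>The inner product of the \<open>i\<close>-th and the \<open>j\<close>-th increment of the embedded path, counted from \<open>0\<close>.\<close>

abbreviation step_inner :: "(int \<Rightarrow> complex) \<Rightarrow> int list \<Rightarrow> nat \<Rightarrow> nat \<Rightarrow> real \<Rightarrow> real" where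
  "step_inner F xs i j t \<equiv> disc_inner (orbit F xs i t) (orbit F xs (Suc i) t)
    (orbit F xs j t) (orbit F xs (Suc j) t)"

lemma one_minus_cmod_orbit:
  assumes "\<forall>n. cmod (F n) < 1"
  shows "1 - (cmod (orbit F xs i t))\<^sup>2 = 1 / (cmod (partial_a F (take i xs) t))\<^sup>2"
proof -
  let ?a = "(cmod (partial_a F (take i xs) t))\<^sup>2" and ?b = "(cmod (partial_b F (take i xs) t))\<^sup>2"
  have "?a \<noteq> 0" using cmod_partial_a_ge_1(2)[OF assms] by simp
  then have "1 - ?b / ?a = (?a - ?b) / ?a" by (simp add: diff_divide_distrib)
  then show ?thesis
    unfolding partial_det[OF assms] by (simp add: orbit_def norm_divide power_divide)
qed

lemma cmod_orbit_less_1: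
  assumes "\<forall>n. cmod (F n) < 1"
  shows "cmod (orbit F xs i t) < 1"
proof -
  have "0 < 1 - (cmod (orbit F xs i t))\<^sup>2"
    unfolding one_minus_cmod_orbit[OF assms] using cmod_partial_a_ge_1[OF assms, where xs = "take i xs" and t = t] by simp
  then show ?thesis by (simp add: abs_square_less_1)
qed

text \<open>
  Invariance of the distance under Moebius transformations. The block between the two prefixes is
  the quotient \<open>P\<^sub>i\<^sup>-\<^sup>1 P\<^sub>j\<close> of the partial products, and its upper left entry is computed from the two
  first rows because \<open>P\<^sub>i\<close> has determinant \<open>1\<close>.
\<close>

lemma disc_sqdist_orbit:
  assumes F: "\<forall>n. cmod (F n) < 1" and "i \<le> j"
  shows "disc_sqdist (orbit F xs i t) (orbit F xs j t)
    = ln ((cmod (partial_a F (drop i (take j xs)) t))\<^sup>2)"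
proof -
  define a b where "a = partial_a F (take i xs) t" and "b = partial_b F (take i xs) t"
  define c d where "c = partial_a F (take j xs) t" and "d = partial_b F (take j xs) t"
  define a' b' where "a' = partial_a F (drop i (take j xs)) t" and "b' = partial_b F (drop i (take j xs)) t"
  have "take j xs = take i xs @ drop i (take j xs)"
    using \<open>i \<le> j\<close> by (metis append_take_drop_id min.absorb1 take_take)
  then have cd: "c = a * a' + b * cnj b'" "d = a * b' + b * cnj a'"
    unfolding a_def b_def c_def d_def a'_def b'_def by (metis partial_append)+
  have nz: "a \<noteq> 0" "c \<noteq> 0" "a' \<noteq> 0"
    using cmod_partial_a_ge_1(2)[OF F] by (simp_all add: a_def c_def a'_def)
  have "cnj a * a - cnj b * b = 1"
  proof -
    have "cnj a * a - cnj b * b = of_real ((cmod a)\<^sup>2 - (cmod b)\<^sup>2)"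
      unfolding of_real_diff complex_norm_square by (simp add: mult.commute)
    then show ?thesis using partial_det[OF F, where xs = "take i xs" and t = t] by (simp add: a_def b_def)
  qed
  then have "cnj a * c - b * cnj d = a'"
    unfolding cd by (simp add: algebra_simps)
  moreover have "1 - orbit F xs i t * cnj (orbit F xs j t) = (cnj a * c - b * cnj d) / (cnj a * c)"
    using nz by (simp add: orbit_def diff_divide_distrib flip: a_def b_def c_def d_def)
  ultimately have "1 - orbit F xs i t * cnj (orbit F xs j t) = a' / (cnj a * c)" by simp
  then have "cmod (1 - orbit F xs i t * cnj (orbit F xs j t)) = cmod a' / (cmod a * cmod c)"
    by (simp add: norm_divide norm_mult)
  then show ?thesis
    using nz unfolding disc_sqdist_def one_minus_cmod_orbit[OF F]
    by (simp add: ln_div ln_mult ln_realpow flip: a_def c_def a'_def)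
qed

lemma continuous_on_disc_sqdist_orbit:
  assumes F: "\<forall>n. cmod (F n) < 1"
  shows "continuous_on T (\<lambda>t. disc_sqdist (orbit F xs i t) (orbit F xs j t))"
proof (cases "i \<le> j")
  case True
  then show ?thesis
    using cmod_partial_a_ge_1[OF F] by (simp add: disc_sqdist_orbit[OF F] continuous_intros)
next
  case False
  then show ?thesis
    using cmod_partial_a_ge_1[OF F]
    by (subst disc_sqdist_commute) (simp add: disc_sqdist_orbit[OF F] continuous_intros)
qed

lemma integral_disc_sqdist_orbit:
  assumes F: "\<forall>n. cmod (F n) < 1" and xs: "sorted_wrt (<) xs" and "i \<le> j" "j \<le> length xs"
  shows "((\<lambda>t. disc_sqdist (orbit F xs i t) (orbit F xs j t)) has_integral
    (\<Sum>k\<in>{i..<j}. ln ((nlft_A F (xs ! k))\<^sup>2))) {0..1}"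
proof -
  have "sorted_wrt (<) (drop i (take j xs))"
    using xs by (simp add: sorted_wrt_take sorted_wrt_drop)
  from has_integral_ln_partial_a[OF F this]
  have "((\<lambda>t. disc_sqdist (orbit F xs i t) (orbit F xs j t)) has_integral
      (\<Sum>n\<leftarrow>drop i (take j xs). ln ((nlft_A F n)\<^sup>2))) {0..1}"
    by (simp add: disc_sqdist_orbit[OF F \<open>i \<le> j\<close>])
  moreover have "(\<Sum>n\<leftarrow>drop i (take j xs). ln ((nlft_A F n)\<^sup>2)) = (\<Sum>k\<in>{i..<j}. ln ((nlft_A F (xs ! k))\<^sup>2))"
  proof -
    have "drop i (take j xs) = map ((!) xs) [i..<j]"
      using assms(3,4) by (intro nth_equalityI) (auto simp: min_def split: if_splits)
    then show ?thesis by (simp add: comp_def interv_sum_list_conv_sum_set_nat)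
  qed
  ultimately show ?thesis by simp
qed

text \<open>
  The mean squared distance is additive along the path, so the four means in the polarization
  formula cancel.
\<close>

lemma disc_inner_orthogonal:
  assumes F: "\<forall>n. cmod (F n) < 1" and xs: "sorted_wrt (<) xs" and ij: "i < j" "j < length xs"
  shows "((\<lambda>t. step_inner F xs i j t)
    has_integral 0) {0..1}"
proof -
  let ?S = "\<lambda>a b. \<Sum>k\<in>{a..<b}. ln ((nlft_A F (xs ! k))\<^sup>2)"
  have "((\<lambda>t. step_inner F xs i j t)
      has_integral (?S i (Suc j) + ?S (Suc i) j - ?S i j - ?S (Suc i) (Suc j)) / 2) {0..1}"
    unfolding disc_inner_def
    by (intro has_integral_divide has_integral_diff has_integral_add integral_disc_sqdist_orbit F xs)
      (use ij in auto)
  moreover have "?S i (Suc j) + ?S (Suc i) j - ?S i j - ?S (Suc i) (Suc j) = 0"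
    using ij by (simp add: sum.atLeastLessThan_Suc)
  ultimately show ?thesis by simp
qed

text \<open>The increments add up to \<open>\<Psi>(w\<^sub>m) - \<Psi>(w\<^sub>0)\<close>; in terms of distances this is a double telescope.\<close>

lemma sum_disc_inner_orbit:
  assumes F: "\<forall>n. cmod (F n) < 1"
  shows "(\<Sum>i<m. \<Sum>j<m. step_inner F xs i j t)
    = disc_sqdist (orbit F xs 0 t) (orbit F xs m t)"
proof -
  let ?d = "\<lambda>i j. disc_sqdist (orbit F xs i t) (orbit F xs j t)"
  have "(\<Sum>j<m. step_inner F xs i j t)
      = (\<Sum>j<m. (?d i (Suc j) - ?d (Suc i) (Suc j)) / 2 - (?d i j - ?d (Suc i) j) / 2)" for i
    by (intro sum.cong refl) (simp add: disc_inner_def field_simps)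
  also have "(\<Sum>j<m. (?d i (Suc j) - ?d (Suc i) (Suc j)) / 2 - (?d i j - ?d (Suc i) j) / 2)
      = (?d i m - ?d (Suc i) m) / 2 - (?d i 0 - ?d (Suc i) 0) / 2" for i
    by (rule sum_lessThan_telescope)
  finally have "(\<Sum>i<m. \<Sum>j<m. step_inner F xs i j t)
      = (\<Sum>i<m. (?d i m - ?d (Suc i) m) / 2 - (?d i 0 - ?d (Suc i) 0) / 2)"
    by (intro sum.cong refl)
  also have "\<dots> = (\<Sum>i<m. (?d (Suc i) 0 - ?d (Suc i) m) / 2 - (?d i 0 - ?d i m) / 2)"
    by (intro sum.cong refl) (simp add: field_simps)
  also have "\<dots> = (?d m 0 - ?d m m) / 2 - (?d 0 0 - ?d 0 m) / 2"
    by (rule sum_lessThan_telescope)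
  also have "\<dots> = ?d 0 m"
    using disc_sqdist_self[OF cmod_orbit_less_1[OF F]] disc_sqdist_commute[of "orbit F xs m t" "orbit F xs 0 t"]
    by (simp add: field_simps)
  finally show ?thesis .
qed

lemma gram_family_orbit:
  assumes F: "\<forall>n. cmod (F n) < 1" and xs: "sorted_wrt (<) xs" and nz: "\<forall>n\<in>set xs. F n \<noteq> 0"
  shows "gram_family {..<length xs} (\<lambda>i. sqrt (ln ((nlft_A F (xs ! i))\<^sup>2)))
    (step_inner F xs)"
proof
  let ?G = "step_inner F xs"
  have pos: "0 < ln ((nlft_A F (xs ! i))\<^sup>2)" if "i < length xs" for i
    using nlft_A_bounds(4)[OF F, of "xs ! i"] nz that by (intro ln_gt_zero) auto
  have sym: "?G i j t = ?G j i t" for i j t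
    unfolding disc_inner_def
    using disc_sqdist_commute[of "orbit F xs i t"] disc_sqdist_commute[of "orbit F xs (Suc i) t"] by simp
  show "finite {..<length xs}" by simp
  show "0 < sqrt (ln ((nlft_A F (xs ! j))\<^sup>2))" if "j \<in> {..<length xs}" for j
    using pos that by simp
  show "continuous_on {0..1} (?G i j)" for i j
    unfolding disc_inner_def by (intro continuous_intros continuous_on_disc_sqdist_orbit[OF F]) simp
  show "?G i j t = ?G j i t" for i j t by (rule sym)
  show "0 \<le> (\<Sum>i<length xs. \<Sum>j<length xs. x i * x j * ?G i j t)" for x t
    by (rule disc_inner_psd) (simp_all add: cmod_orbit_less_1[OF F])
  show "?G j j t = (sqrt (ln ((nlft_A F (xs ! j))\<^sup>2)))\<^sup>2" if j: "j \<in> {..<length xs}" for j t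
  proof -
    have "drop j (take (Suc j) xs) = [xs ! j]" using j by (simp add: take_Suc_conv_app_nth)
    then have "disc_sqdist (orbit F xs j t) (orbit F xs (Suc j) t) = ln ((nlft_A F (xs ! j))\<^sup>2)"
      using nlft_A_bounds(2)[OF F] by (simp add: disc_sqdist_orbit[OF F] partial_Cons norm_mult)
    then show ?thesis
      using pos[of j] j disc_sqdist_self[OF cmod_orbit_less_1[OF F]]
        disc_sqdist_commute[of "orbit F xs (Suc j) t" "orbit F xs j t"]
      by (simp add: disc_inner_def less_imp_le)
  qed
  show "(?G i j has_integral 0) {0..1}" if "i \<in> {..<length xs}" "j \<in> {..<length xs}" "i \<noteq> j" for i j
  proof (cases "i < j")
    case True
    then show ?thesis using disc_inner_orthogonal[OF F xs] that by simp
  next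
    case False
    then have "(?G j i has_integral 0) {0..1}" using disc_inner_orthogonal[OF F xs, of j i] that by simp
    then show ?thesis by (rule has_integral_eq[rotated]) (rule sym)
  qed
qed

lemma norm_sum_sq_orbit:
  assumes F: "\<forall>n. cmod (F n) < 1" and xs: "sorted_wrt (<) xs" and nz: "\<forall>n\<in>set xs. F n \<noteq> 0"
  shows "gram_family.norm_sum_sq {..<length xs}
    (step_inner F xs) t
    = ln ((cmod (partial_a F xs t))\<^sup>2)"
  unfolding gram_family.norm_sum_sq_def[OF gram_family_orbit[OF F xs nz]] sum_disc_inner_orbit[OF F] by (simp add: disc_sqdist_orbit[OF F])

section \<open>The norms and the theorem\<close>

lemma nn_integral_circle_measure:
  assumes "(g has_integral I) {0..1}" and nonneg: "\<And>t. t \<in> {0..1} \<Longrightarrow> 0 \<le> g t"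
  shows "(\<integral>\<^sup>+ t. ennreal (g t) \<partial>circle_measure) = ennreal I"
proof -
  have "(g has_integral I) {0..1} \<longleftrightarrow> (g has_integral I) {0..<1}"
    by (rule has_integral_spike_set_eq) (auto intro: negligible_subset[of "{1}"])
  then have "(g has_integral I) {0..<1}" using assms(1) by simp
  then have "integral\<^sup>N lborel (\<lambda>t. ennreal (g t) * indicator {0..<1} t) = ennreal I"
    by (intro nn_integral_has_integral_lebesgue') (use nonneg in auto)
  then show ?thesis
    unfolding circle_measure_def by (simp add: nn_integral_restrict_space nn_integral_completion)
qed

lemma Lp_norm_circle_measure:
  assumes "((\<lambda>t. \<bar>f t\<bar> powr q) has_integral I) {0..1}" and "0 < q"
  shows "Lp_norm circle_measure (ennreal q) f = ennreal (I powr (1 / q))"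
proof -
  have "0 \<le> I" by (rule has_integral_nonneg[OF assms(1)]) simp
  then show ?thesis
    using nn_integral_circle_measure[OF assms(1)] \<open>0 < q\<close> by (simp add: Lp_norm_def Let_def)
qed

lemma Lp_norm_count_space:
  assumes "finite X" and "\<And>n. n \<notin> X \<Longrightarrow> f n = 0" and "0 < q"
  shows "Lp_norm (count_space UNIV) (ennreal q) f = ennreal ((\<Sum>n\<in>X. \<bar>f n\<bar> powr q) powr (1 / q))"
proof -
  have "(\<integral>\<^sup>+ n. ennreal (\<bar>f n\<bar> powr q) \<partial>count_space UNIV) = (\<Sum>n\<in>X. ennreal (\<bar>f n\<bar> powr q))"
    using assms by (intro nn_integral_count_space') auto
  also have "\<dots> = ennreal (\<Sum>n\<in>X. \<bar>f n\<bar> powr q)" by (rule sum_ennreal) simp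
  finally show ?thesis using \<open>0 < q\<close> by (simp add: Lp_norm_def Let_def sum_nonneg)
qed

lemma conj_exponent_eq:
  assumes "1 < p"
  shows "conj_exponent p = ennreal (p / (p - 1))"
  using assms by (simp add: conj_exponent_def)

lemma Lp_norm_circle_measure_const:
  assumes "1 \<le> p" and "0 \<le> c"
  shows "Lp_norm circle_measure (conj_exponent p) (\<lambda>_. c) = ennreal c"
proof (cases "p = 1")
  case True
  have "emeasure circle_measure (space circle_measure) = 1"
    by (simp add: circle_measure_def emeasure_restrict_space space_restrict_space)
  then show ?thesis using True \<open>0 \<le> c\<close> by (simp add: conj_exponent_def Lp_norm_def esssup_const)
next
  case False
  define q where "q = p / (p - 1)"
  have "q > 0" using False \<open>1 \<le> p\<close> by (simp add: q_def)
  have "((\<lambda>t::real. \<bar>c\<bar> powr q) has_integral c powr q) {0..1}"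
    using has_integral_const_real[of "\<bar>c\<bar> powr q" 0 1] \<open>0 \<le> c\<close> by simp
  from Lp_norm_circle_measure[OF this \<open>q > 0\<close>]
  show ?thesis using False assms \<open>q > 0\<close> by (simp add: conj_exponent_eq powr_powr flip: q_def)
qed

theorem theorem1p1:
  fixes F :: "int \<Rightarrow> complex"
  assumes "finite {n. F n \<noteq> 0}"
    and "\<And>n. cmod (F n) < 1"
  shows "(\<forall>p::real. 1 \<le> p \<and> p \<le> 2 \<longrightarrow>
            Lp_norm circle_measure (conj_exponent p) (\<lambda>t. sqrt (ln ((cmod (nlft_a F t))\<^sup>2)))
              \<le> Lp_norm (count_space UNIV) (ennreal p) (\<lambda>n. sqrt (ln ((nlft_A F n)\<^sup>2))))
       \<and> ((\<exists>!n. F n \<noteq> 0) \<longrightarrow>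
            (\<forall>p::real. 1 \<le> p \<and> p \<le> 2 \<longrightarrow>
              Lp_norm circle_measure (conj_exponent p) (\<lambda>t. sqrt (ln ((cmod (nlft_a F t))\<^sup>2)))
                = Lp_norm (count_space UNIV) (ennreal p) (\<lambda>n. sqrt (ln ((nlft_A F n)\<^sup>2)))))
       \<and> Lp_norm circle_measure (conj_exponent 2) (\<lambda>t. sqrt (ln ((cmod (nlft_a F t))\<^sup>2)))
            = Lp_norm (count_space UNIV) 2 (\<lambda>n. sqrt (ln ((nlft_A F n)\<^sup>2)))"
proof -
  define X where "X = {n. F n \<noteq> 0}"
  define xs where "xs = sorted_list_of_set X"
  define a where "a = (\<lambda>t. sqrt (ln ((cmod (nlft_a F t))\<^sup>2)))"
  define A where "A = (\<lambda>n. sqrt (ln ((nlft_A F n)\<^sup>2)))"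
  have F: "\<forall>n. cmod (F n) < 1" using assms(2) by simp
  have X: "finite X" using assms(1) by (simp add: X_def)
  have xs: "sorted_wrt (<) xs" "distinct xs" "set xs = X"
    using X by (simp_all add: xs_def)
  have nz: "\<forall>n\<in>set xs. F n \<noteq> 0" by (simp add: xs X_def)
  have a_eq: "nlft_a F t = partial_a F xs t" for t
    by (simp add: nlft_a_def nlft_matrix_def partial_a_def xs_def X_def)
  have sum_xs: "(\<Sum>i<length xs. g (xs ! i)) = (\<Sum>n\<in>X. g n)" for g :: "int \<Rightarrow> real"
    using sum.reindex_bij_betw[OF bij_betw_nth[OF xs(2) refl refl], of g] by (simp add: xs(3))
  have A_outside: "A n = 0" if "n \<notin> X" for n
    using that by (simp add: A_def X_def nlft_A_def)
  have A_nonneg: "0 \<le> A n" for n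
    using nlft_A_bounds(3)[OF F, of n] by (simp add: A_def)
  have count: "Lp_norm (count_space UNIV) (ennreal p) A = ennreal ((\<Sum>n\<in>X. A n powr p) powr (1 / p))"
    if "0 < p" for p
    using Lp_norm_count_space[OF X A_outside that] A_nonneg by simp

  interpret gram_family "{..<length xs}" "\<lambda>i. sqrt (ln ((nlft_A F (xs ! i))\<^sup>2))"
    "step_inner F xs"
    by (rule gram_family_orbit[OF F xs(1) nz])
  have u_eq: "norm_sum_sq t = ln ((cmod (nlft_a F t))\<^sup>2)" for t
    unfolding a_eq by (rule norm_sum_sq_orbit[OF F xs(1) nz])
  have u_ge_0: "0 \<le> norm_sum_sq t" for t
    using cmod_partial_a_ge_1(1)[OF F] by (simp add: u_eq a_eq)
  have a_u: "a t = sqrt (norm_sum_sq t)" for t by (simp add: a_def u_eq)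

  have at_2: "Lp_norm circle_measure (conj_exponent 2) a = Lp_norm (count_space UNIV) 2 A"
  proof -
    have "((\<lambda>t. ln ((cmod (partial_a F xs t))\<^sup>2)) has_integral (\<Sum>n\<leftarrow>xs. ln ((nlft_A F n)\<^sup>2))) {0..1}"
      by (rule has_integral_ln_partial_a[OF F xs(1)])
    moreover have "(\<Sum>n\<leftarrow>xs. ln ((nlft_A F n)\<^sup>2)) = (\<Sum>n\<in>X. A n powr 2)"
      using xs(2,3) nlft_A_bounds(3)[OF F] A_nonneg
      by (simp add: sum_list_distinct_conv_sum_set A_def)
    moreover have "\<bar>a t\<bar> powr 2 = ln ((cmod (partial_a F xs t))\<^sup>2)" for t
      using u_ge_0[of t] by (simp add: a_u u_eq a_eq)
    ultimately have "((\<lambda>t. \<bar>a t\<bar> powr 2) has_integral (\<Sum>n\<in>X. A n powr 2)) {0..1}" by simp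
    from Lp_norm_circle_measure[OF this] count[of 2]
    show ?thesis by (simp add: conj_exponent_eq)
  qed
  have at_1: "Lp_norm circle_measure (conj_exponent 1) a \<le> Lp_norm (count_space UNIV) (ennreal 1) A"
  proof -
    have "continuous_on {0..<1} a"
      unfolding a_u[abs_def]
      by (intro continuous_on_real_sqrt continuous_on_subset[OF continuous_on_norm_sum_sq]) auto
    then have "a \<in> borel_measurable circle_measure"
      unfolding circle_measure_def by (intro continuous_imp_measurable_on_sets_lebesgue) auto
    then have "(\<lambda>t. ennreal \<bar>a t\<bar>) \<in> borel_measurable circle_measure" by measurable
    moreover have "AE t in circle_measure. ennreal \<bar>a t\<bar> \<le> ennreal (\<Sum>n\<in>X. A n)"
    proof (rule AE_I2)
      fix t assume "t \<in> space circle_measure"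
      then have "t \<in> {0..1}" by (auto simp: circle_measure_def space_restrict_space)
      then show "ennreal \<bar>a t\<bar> \<le> ennreal (\<Sum>n\<in>X. A n)"
        using sqrt_norm_sum_sq_le_sum[of t] u_ge_0[of t] sum_xs[of A] by (intro ennreal_leI) (simp add: a_u A_def)
    qed
    ultimately have "esssup circle_measure (\<lambda>t. ennreal \<bar>a t\<bar>) \<le> ennreal (\<Sum>n\<in>X. A n)"
      by (rule esssup_I)
    then show ?thesis
      using count[of 1] A_nonneg by (simp add: conj_exponent_def Lp_norm_def sum_nonneg)
  qed
  have between: "Lp_norm circle_measure (conj_exponent p) a \<le> Lp_norm (count_space UNIV) (ennreal p) A"
    if p: "1 < p" "p < 2" for p
  proof -
    \<comment> \<open>Half of the conjugate exponent, because \<open>norm_sum_sq\<close> is a squared norm.\<close>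
    define r where "r = p / (2 * (p - 1))"
    have r: "r > 1" "p / (p - 1) = 2 * r" "2 * r / (2 * r - 1) = p" "(2 * r - 1) * (1 / (2 * r)) = 1 / p"
      using p by (auto simp: r_def field_simps)
    have "continuous_on {0..1} (\<lambda>t. norm_sum_sq t powr r)"
      using r(1) by (intro continuous_on_powr' continuous_on_norm_sum_sq continuous_on_const) (simp add: u_ge_0)
    then have "((\<lambda>t. norm_sum_sq t powr r) has_integral integral {0..1} (\<lambda>t. norm_sum_sq t powr r)) {0..1}"
      by (intro integrable_integral integrable_continuous_real)
    moreover have "\<bar>a t\<bar> powr (2 * r) = norm_sum_sq t powr r" for t
      using u_ge_0[of t] by (simp add: a_u powr_powr flip: powr_half_sqrt)
    ultimately have "((\<lambda>t. \<bar>a t\<bar> powr (2 * r)) has_integral integral {0..1} (\<lambda>t. norm_sum_sq t powr r)) {0..1}"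
      by simp
    from Lp_norm_circle_measure[OF this] have
      "Lp_norm circle_measure (conj_exponent p) a = ennreal (integral {0..1} (\<lambda>t. norm_sum_sq t powr r) powr (1 / (2 * r)))"
      using p r by (simp add: conj_exponent_eq)
    also have "\<dots> \<le> ennreal (((\<Sum>n\<in>X. A n powr p) powr (2 * r - 1)) powr (1 / (2 * r)))"
    proof (intro ennreal_leI powr_mono2)
      show "0 \<le> integral {0..1} (\<lambda>t. norm_sum_sq t powr r)"
        using \<open>continuous_on {0..1} (\<lambda>t. norm_sum_sq t powr r)\<close>
        by (intro integral_nonneg integrable_continuous_real) auto
      show "integral {0..1} (\<lambda>t. norm_sum_sq t powr r) \<le> (\<Sum>n\<in>X. A n powr p) powr (2 * r - 1)"
        using gram_hausdorff_young[OF r(1)] sum_xs[of "\<lambda>n. A n powr p"] unfolding r(3) by (simp add: A_def)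
    qed (use r in simp)
    also have "\<dots> = Lp_norm (count_space UNIV) (ennreal p) A"
      using p count[of p] unfolding powr_powr r(4) by simp
    finally show ?thesis .
  qed
  have single: "Lp_norm circle_measure (conj_exponent p) a = Lp_norm (count_space UNIV) (ennreal p) A"
    if "\<exists>!n. F n \<noteq> 0" "1 \<le> p" for p
  proof -
    from that(1) obtain n where n: "X = {n}" by (auto simp: X_def)
    then have "a = (\<lambda>_. A n)"
      using nlft_A_bounds(2)[OF F, of n]
      by (simp add: a_def A_def a_eq xs_def partial_Cons)
    then show ?thesis
      using Lp_norm_circle_measure_const[OF that(2) A_nonneg[of n]] count[of p] that(2) A_nonneg[of n]
      by (simp add: n powr_powr)
  qed
  have "Lp_norm circle_measure (conj_exponent p) a \<le> Lp_norm (count_space UNIV) (ennreal p) A"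
    if "1 \<le> p" "p \<le> 2" for p
    using that at_1 at_2 between[of p] by (cases "p = 1 \<or> p = 2") auto
  then show ?thesis using single at_2 unfolding a_def A_def by blast
qed

end
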